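(* Let $s\ge2$ and $t\ge1$ be coprime integers, let $u=\lfloor s/2\rfloor$, and let $\lambda\in\mathcal D_s$ be a self-conjugate $s$-core. For $i\in\mathbb Z$ let $c_i=|\mathcal S(\lambda)\cap(i+t\mathbb Z)|$. Let $\operatorname{StabSC}_{s,t}(\lambda)$ be the stabiliser of $\lambda$ under the level $t$ action of $\tilde{\mathfrak H}_s$ on $\mathcal D_s$. \begin{enumerate} \item If $s$ and $t$ are both odd, let $y=(c_u-1)/2$. Then \[|\operatorname{StabSC}_{s,t}(\lambda)|=2^y\,y!\prod_{i=u+1}^{u+(t-1)/2}c_i!.\] \item If $t$ is even, let $y=(c_u-1)/2$ and $z=c_{u+t/2}/2$. Then \[|\operatorname{StabSC}_{s,t}(\lambda)|=2^{y+z}\,y!\,z!\prod_{i=u+1}^{u+(t-2)/2}c_i!.\] \item If $s$ is even, let $y=c_{u+(t-1)/2}/2$. Then \[|\operatorname{StabSC}_{s,t}(\lambda)|=2^y\,y!\prod_{i=u}^{u+(t-3)/2}c_i!.\] \end{enumerate}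
   Context: Let $\mathbb N=\{1,2,\dots\}$ and $s\circ t=\frac12(s-1)(t-1)$ (an integer, since $s,t$ are coprime). A partition is a weakly decreasing sequence $\lambda=(\lambda_1,\lambda_2,\dots)$ of non-negative integers, eventually $0$; its conjugate is $\lambda'$ with $\lambda'_i=|\{j\ge1:\lambda_j\ge i\}|$, and $\lambda$ is self-conjugate if $\lambda=\lambda'$. For $(r,c)\in\mathbb N^2$ with $c\le\lambda_r$, the $(r,c)$-hook length of $\lambda$ is $1+(\lambda_r-r)+(\lambda'_c-c)$. $\lambda$ is an $s$-core if none of its hook lengths equals $s$; $\mathcal C_s$ is the set of all $s$-cores and $\mathcal D_s$ the set of all self-conjugate $s$-cores. The beta-set of $\lambda$ is $\mathcal B^\lambda=\{\lambda_i-i: i\in\mathbb N\}$. Affine symmetric group: $\tilde{\mathfrak S}_s$ is the group of permutations $w$ of $\mathbb Z$ with $w(m+s)=w(m)+s$ for all $m$ and $w(0)+\dots+w(s-1)=\binom s2$. Elements of $\mathbb Z/s\mathbb Z$ are regarded as congruence classes, i.e. subsets of $\mathbb Z$, and $\overline a=a+s\mathbb Z$; for $i\in\mathbb Z/s\mathbb Z$ and integers $a,b$, $ia+b$ denotes the class of $xa+b$ for $x\in i$. For $i\in\mathbb Z/s\mathbb Z$, $w_i\in\tilde{\mathfrak S}_s$ is given by $w_i(m)=m+1$ if $m\in i-1$, $w_i(m)=m-1$ if $m\in i$, and $w_i(m)=m$ otherwise; the $w_i$ generate $\tilde{\mathfrak S}_s$. Level $t$ action: the level $t$ action $w\mapsto\mathring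 w$ of $\tilde{\mathfrak S}_s$ on $\mathbb Z$ is the action determined on generators by $\mathring w_i(m)=m+t$ if $m\in(i-1)t-s\circ t$, $\mathring w_i(m)=m-t$ if $m\in it-s\circ t$, and $\mathring w_i(m)=m$ otherwise. The level $t$ action $w\mapsto\check w$ on $\mathcal C_s$ is defined by letting $\check w\lambda$ be the unique partition with $\mathcal B^{\check w\lambda}=\mathring w(\mathcal B^\lambda)$ (this is again an $s$-core). Subgroup $\tilde{\mathfrak H}_s$: for $i\in\mathbb Z/s\mathbb Z$ let $v_i=w_i$ if $i=\overline0$; $v_i=w_iw_{-i}$ if $i=\overline l$ or $-\overline l$ with $1\le l<u$; $v_i=w_iw_{-i}w_i$ if $i=\overline u$ or $-\overline u$. Then $\tilde{\mathfrak H}_s=\langle v_i: i\in\mathbb Z/s\mathbb Z\rangle\le\tilde{\mathfrak S}_s$. The action $w\mapsto\check w$ restricted to $\tilde{\mathfrak H}_s$ preserves $\mathcal D_s$; this restriction is the level $t$ action of $\tilde{\mathfrak H}_s$ on $\mathcal D_s$. $s$-sets: for an $s$-core $\lambda$, $\mathcal S(\lambda)=\{a_i: i\in\mathbb Z/s\mathbb Z\}$, where $a_i$ is the smallest integer in $i$ not in $\mathcal B^\lambda$. Empty products equal $1$. *)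

theory Defs
  imports Complex_Main "HOL-Number_Theory.Cong" "HOL-Algebra.Group_Action" "HOL-Algebra.Elementary_Groups"
begin

text \<open>
  A partition is a function on \<^typ>\<open>nat\<close> with parts indexed from 0: the value \<open>p i\<close> is the part
  \<open>\<lambda>\<^sub>i\<^sub>+\<^sub>1\<close>.  Rows and columns of the Young diagram are shifted in the same way, so the node
  \<open>(r, c)\<close> below is the node \<open>(r + 1, c + 1)\<close> in 1-based coordinates.
\<close>

definition is_partition :: "(nat \<Rightarrow> nat) \<Rightarrow> bool" where
  "is_partition p \<longleftrightarrow> antimono p \<and> (\<exists>N. \<forall>i\<ge>N. p i = 0)"

definition conjugate :: "(nat \<Rightarrow> nat) \<Rightarrow> nat \<Rightarrow> nat" where
  "conjugate p i = card {j. p j \<ge> i + 1}"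

definition hook_length :: "(nat \<Rightarrow> nat) \<Rightarrow> nat \<Rightarrow> nat \<Rightarrow> int" where
  "hook_length p r c =
     1 + (int (p r) - int (r + 1)) + (int (conjugate p c) - int (c + 1))"

definition cores :: "int \<Rightarrow> (nat \<Rightarrow> nat) set" where
  "cores s = {p. is_partition p \<and> (\<forall>r c. c + 1 \<le> p r \<longrightarrow> hook_length p r c \<noteq> s)}"

definition self_conj_cores :: "int \<Rightarrow> (nat \<Rightarrow> nat) set" where
  "self_conj_cores s = {p \<in> cores s. conjugate p = p}"

definition beta_set :: "(nat \<Rightarrow> nat) \<Rightarrow> int set" where
  "beta_set p = {int (p i) - int (i + 1) | i. True}"

text \<open>
  Congruence classes modulo \<open>s\<close> are indexed by integer representatives; everything indexed by
  a class below depends only on the class of the index modulo \<open>s\<close>.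
\<close>

definition affine_sym :: "int \<Rightarrow> (int \<Rightarrow> int) monoid" where
  "affine_sym s = (BijGroup UNIV)
     \<lparr>carrier := {w. bij w \<and> (\<forall>m. w (m + s) = w m + s)
                      \<and> (\<Sum>m = 0..s - 1. w m) = int (nat s choose 2)}\<rparr>"

definition w_gen :: "int \<Rightarrow> int \<Rightarrow> int \<Rightarrow> int" where
  "w_gen s i m =
     (if [m = i - 1] (mod s) then m + 1 else if [m = i] (mod s) then m - 1 else m)"

definition circ :: "int \<Rightarrow> int \<Rightarrow> int" where
  "circ s t = (s - 1) * (t - 1) div 2"

definition level_gen :: "int \<Rightarrow> int \<Rightarrow> int \<Rightarrow> int \<Rightarrow> int" where
  "level_gen s t i m =
     (if [m = (i - 1) * t - circ s t] (mod s) then m + t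
      else if [m = i * t - circ s t] (mod s) then m - t else m)"

text \<open>
  Since the \<^const>\<open>w_gen\<close> generate \<^const>\<open>affine_sym\<close>, any two actions satisfying the condition
  below agree on the whole group, so the choice is immaterial.  Existence for coprime \<open>s\<close>
  and \<open>t\<close> is shown in \<open>level_action_exists\<close>.
\<close>

definition level_action :: "int \<Rightarrow> int \<Rightarrow> (int \<Rightarrow> int) \<Rightarrow> int \<Rightarrow> int" where
  "level_action s t =
     (SOME \<phi>. group_action (affine_sym s) UNIV \<phi> \<and> (\<forall>i. \<phi> (w_gen s i) = level_gen s t i))"

definition level_action_cores ::
    "int \<Rightarrow> int \<Rightarrow> (int \<Rightarrow> int) \<Rightarrow> (nat \<Rightarrow> nat) \<Rightarrow> nat \<Rightarrow> nat" where
  "level_action_cores s t w =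
     (\<lambda>p\<in>cores s. THE q. is_partition q \<and> beta_set q = level_action s t w ` beta_set p)"

definition v_gen :: "int \<Rightarrow> int \<Rightarrow> int \<Rightarrow> int" where
  "v_gen s i =
     (if [i = 0] (mod s) then w_gen s i
      else if \<exists>l. 1 \<le> l \<and> l < s div 2 \<and> ([i = l] (mod s) \<or> [i = - l] (mod s))
      then w_gen s i \<circ> w_gen s (- i)
      else w_gen s i \<circ> w_gen s (- i) \<circ> w_gen s i)"
  \<comment> \<open>the last case is exactly that of \<open>i\<close> congruent to \<open>s div 2\<close> or \<open>- (s div 2)\<close>\<close>

definition affine_hyp :: "int \<Rightarrow> (int \<Rightarrow> int) monoid" where
  "affine_hyp s = subgroup_generated (affine_sym s) (range (v_gen s))"

definition level_action_self_conj ::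
    "int \<Rightarrow> int \<Rightarrow> (int \<Rightarrow> int) \<Rightarrow> (nat \<Rightarrow> nat) \<Rightarrow> nat \<Rightarrow> nat" where
  "level_action_self_conj s t =
     (\<lambda>w\<in>carrier (affine_hyp s). restrict (level_action_cores s t w) (self_conj_cores s))"

definition StabSC :: "int \<Rightarrow> int \<Rightarrow> (nat \<Rightarrow> nat) \<Rightarrow> (int \<Rightarrow> int) set" where
  "StabSC s t p = stabilizer (affine_hyp s) (level_action_self_conj s t) p"

definition s_set :: "int \<Rightarrow> (nat \<Rightarrow> nat) \<Rightarrow> int set" where
  "s_set s p = {(LEAST a. [a = i] (mod s) \<and> a \<notin> beta_set p) | i. True}"

definition s_set_count :: "int \<Rightarrow> int \<Rightarrow> (nat \<Rightarrow> nat) \<Rightarrow> int \<Rightarrow> nat" where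
  "s_set_count s t p i = card (s_set s p \<inter> {m. [m = i] (mod t)})"


lemma sum_int_choose_two: "(\<Sum>m = 0..int n - 1. m) = int (n choose 2)"
proof (induction n)
  case 0
  then show ?case by simp
next
  case (Suc n)
  have "{0..int (Suc n) - 1} = insert (int n) {0..int n - 1}" by auto
  then show ?case using Suc by (simp add: numeral_2_eq_2)
qed

lemma shift_mult:
  fixes w :: "int \<Rightarrow> int"
  assumes "\<And>m. w (m + s) = w m + s"
  shows "w (m + k * s) = w m + k * s"
proof (induction k rule: int_induct[where k = 0])
  case base
  show ?case by simp
next
  case (step1 i)
  then show ?case using assms[of "m + i * s"] by (simp add: algebra_simps)
next
  case (step2 i)
  then show ?case using assms[of "m + (i - 1) * s"] by (simp add: algebra_simps)
qed

lemma sum_periodic_reindex: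
  fixes w d :: "int \<Rightarrow> int"
  assumes s: "s > 0" and inj: "inj w" and w: "\<And>m. w (m + s) = w m + s"
    and d: "\<And>m n. [m = n] (mod s) \<Longrightarrow> d m = d n"
  shows "(\<Sum>m = 0..s - 1. d (w m)) = (\<Sum>m = 0..s - 1. d m)"
proof -
  have "inj_on (\<lambda>m. w m mod s) {0..s - 1}"
  proof (rule inj_onI)
    fix m n assume mn: "m \<in> {0..s - 1}" "n \<in> {0..s - 1}" "w m mod s = w n mod s"
    then obtain k where "w m = w n + s * k"
      by (metis cong_def cong_iff_lin cong_sym)
    then have "w m = w (n + k * s)" using shift_mult[of w s n k, OF w] by (simp add: mult.commute)
    then have "m = n + k * s" using inj by (simp add: inj_eq)
    then have "m mod s = n mod s" by simp
    with mn show "m = n" by simp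
  qed
  moreover have "(\<lambda>m. w m mod s) ` {0..s - 1} \<subseteq> {0..s - 1}" using s by auto
  ultimately have "bij_betw (\<lambda>m. w m mod s) {0..s - 1} {0..s - 1}"
    by (simp add: bij_betw_def endo_inj_surj)
  then have "(\<Sum>m = 0..s - 1. d (w m mod s)) = (\<Sum>m = 0..s - 1. d m)"
    by (rule sum.reindex_bij_betw)
  moreover have "d (w m mod s) = d (w m)" for m by (rule d) simp
  ultimately show ?thesis by simp
qed

lemma BijGroup_UNIV [simp]:
  "carrier (BijGroup UNIV) = {f. bij f}"
  "\<one>\<^bsub>BijGroup UNIV\<^esub> = id"
  "bij f \<Longrightarrow> bij g \<Longrightarrow> f \<otimes>\<^bsub>BijGroup UNIV\<^esub> g = f \<circ> g"
  by (auto simp: BijGroup_def Bij_def compose_def restrict_def fun_eq_iff)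

lemma affine_sym_iff:
  assumes "s > 0"
  shows "w \<in> carrier (affine_sym s) \<longleftrightarrow>
    bij w \<and> (\<forall>m. w (m + s) = w m + s) \<and> (\<Sum>m = 0..s - 1. w m - m) = 0"
  using sum_int_choose_two[of "nat s"] assms by (auto simp: affine_sym_def sum_subtractf)

lemma displacement_cong:
  fixes w :: "int \<Rightarrow> int"
  assumes "\<And>m. w (m + s) = w m + s" "[m = n] (mod s)"
  shows "w m - m = w n - n"
proof -
  obtain k where "m = n + k * s" using assms(2) by (metis cong_iff_lin cong_sym mult.commute)
  then show ?thesis using shift_mult[of w s n k, OF assms(1)] by simp
qed

lemma subgroup_affine_sym:
  assumes s: "s > 0"
  shows "subgroup (carrier (affine_sym s)) (BijGroup UNIV)"
proof -
  interpret B: group "BijGroup (UNIV :: int set)" by (rule group_BijGroup)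
  have comp: "v \<circ> w \<in> carrier (affine_sym s)"
    if v: "v \<in> carrier (affine_sym s)" and w: "w \<in> carrier (affine_sym s)" for v w
  proof -
    have vw: "bij v" "bij w" "\<And>m. v (m + s) = v m + s" "\<And>m. w (m + s) = w m + s"
      using v w s by (auto simp: affine_sym_iff)
    have "(\<Sum>m = 0..s - 1. v (w m) - w m) = (\<Sum>m = 0..s - 1. v m - m)"
      using sum_periodic_reindex[of s w "\<lambda>m. v m - m"] displacement_cong[of v s] vw s
      by (simp add: bij_is_inj)
    moreover have "(\<Sum>m = 0..s - 1. v (w m) - m) =
        (\<Sum>m = 0..s - 1. v (w m) - w m) + (\<Sum>m = 0..s - 1. w m - m)"
      by (simp flip: sum.distrib)
    ultimately show ?thesis
      using v w s vw by (simp add: affine_sym_iff bij_comp)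
  qed
  have inv: "inv\<^bsub>BijGroup UNIV\<^esub> w \<in> carrier (affine_sym s)"
    if w: "w \<in> carrier (affine_sym s)" for w
  proof -
    have bw: "bij w" "\<And>m. w (m + s) = w m + s" and sw: "(\<Sum>m = 0..s - 1. w m - m) = 0"
      using w s by (auto simp: affine_sym_iff)
    define x where "x = inv_into UNIV w"
    have bx: "bij x" using bw(1) by (simp add: x_def bij_imp_bij_inv)
    have wx: "w (x m) = m" "x (w m) = m" for m
      using bw(1) by (simp_all add: x_def bij_is_surj bij_is_inj surj_f_inv_f)
    have px: "x (m + s) = x m + s" for m
      using bw(2)[of "x m"] wx by metis
    have "(\<Sum>m = 0..s - 1. x (w m) - w m) = (\<Sum>m = 0..s - 1. x m - m)"
      using sum_periodic_reindex[of s w "\<lambda>m. x m - m"] displacement_cong[of x s] bw px s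
      by (simp add: bij_is_inj)
    moreover have "(\<Sum>m = 0..s - 1. x (w m) - w m) = - (\<Sum>m = 0..s - 1. w m - m)"
      by (simp add: wx flip: sum_negf)
    ultimately have "x \<in> carrier (affine_sym s)"
      using bx px sw s by (simp add: affine_sym_iff)
    moreover have "inv\<^bsub>BijGroup UNIV\<^esub> w = x"
      using bw(1) bx by (intro B.inv_equality) (auto simp: wx)
    ultimately show ?thesis by simp
  qed
  show ?thesis
  proof (rule B.subgroupI)
    show "carrier (affine_sym s) \<subseteq> carrier (BijGroup UNIV)" by (auto simp: affine_sym_def)
    have "id \<in> carrier (affine_sym s)" using s by (simp add: affine_sym_iff)
    then show "carrier (affine_sym s) \<noteq> {}" by blast
    show "v \<otimes>\<^bsub>BijGroup UNIV\<^esub> w \<in> carrier (affine_sym s)"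
      if "v \<in> carrier (affine_sym s)" "w \<in> carrier (affine_sym s)" for v w
      using comp[OF that] that s by (simp add: affine_sym_iff)
  qed (rule inv)
qed

lemma level_action_exists:
  fixes s t :: int
  assumes s: "s \<ge> 2" and co: "coprime s t"
  shows "\<exists>\<phi>. group_action (affine_sym s) UNIV \<phi> \<and> (\<forall>i. \<phi> (w_gen s i) = level_gen s t i)"
proof -
  obtain t' where t': "[t * t' = 1] (mod s)"
    using cong_solve_coprime_int[of t s] co by (auto simp: coprime_commute)
  define a where "a m = (m + circ s t) * t'" for m
  define \<phi> where "\<phi> w m = m + t * (w (a m) - a m)" for w m
  have a_iff: "[m = n * t - circ s t] (mod s) \<longleftrightarrow> [a m = n] (mod s)" for m n
  proof
    assume "[m = n * t - circ s t] (mod s)"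
    then have "[(m + circ s t) * t' = n * (t * t')] (mod s)"
      using cong_add_rcancel[of m "circ s t" "n * t - circ s t" s]
      by (metis cong_scalar_right diff_add_cancel mult.assoc)
    also have "[n * (t * t') = n * 1] (mod s)" using t' by (rule cong_scalar_left)
    finally show "[a m = n] (mod s)" by (simp add: a_def)
  next
    assume "[a m = n] (mod s)"
    then have "[n * t = (m + circ s t) * (t * t')] (mod s)"
      unfolding a_def by (metis cong_scalar_right cong_sym mult.assoc mult.commute)
    also have "[(m + circ s t) * (t * t') = (m + circ s t) * 1] (mod s)"
      using t' by (rule cong_scalar_left)
    finally show "[m = n * t - circ s t] (mod s)"
      by (metis add_diff_cancel_right' cong_diff cong_refl cong_sym mult.right_neutral)
  qed
  have a_shift: "[a (m + t * k) = a m + k] (mod s)" for m k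
  proof -
    have "a (m + t * k) = a m + k * (t * t')" by (simp add: a_def algebra_simps)
    moreover have "[a m + k * (t * t') = a m + k * 1] (mod s)"
      using t' by (intro cong_add cong_refl cong_scalar_left)
    ultimately show ?thesis by simp
  qed
  have comp: "\<phi> (v \<circ> w) = \<phi> v \<circ> \<phi> w"
    if v: "v \<in> carrier (affine_sym s)" for v w
  proof
    fix m
    have "[a (\<phi> w m) = w (a m)] (mod s)"
      using a_shift[of m "w (a m) - a m"] by (simp add: \<phi>_def)
    then have "v (a (\<phi> w m)) - a (\<phi> w m) = v (w (a m)) - w (a m)"
      using v s by (intro displacement_cong) (auto simp: affine_sym_iff)
    then show "\<phi> (v \<circ> w) m = (\<phi> v \<circ> \<phi> w) m"
      by (simp add: \<phi>_def[of v] \<phi>_def[of "v \<circ> w"]) (simp add: \<phi>_def algebra_simps)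
  qed
  interpret B: group "BijGroup (UNIV :: int set)" by (rule group_BijGroup)
  have sub: "subgroup (carrier (affine_sym s)) (BijGroup UNIV)"
    using s by (intro subgroup_affine_sym) simp
  have G: "group (affine_sym s)"
    using B.subgroup_imp_group[OF sub] by (simp add: affine_sym_def)
  have bij: "bij (\<phi> w)" if w: "w \<in> carrier (affine_sym s)" for w
  proof -
    have bw: "bij w" using w s by (simp add: affine_sym_iff)
    obtain x where x: "x = inv\<^bsub>BijGroup UNIV\<^esub> w" by simp
    have xc: "x \<in> carrier (affine_sym s)"
      using subgroup.m_inv_closed[OF sub w] x by simp
    then have bx: "bij x" using s by (simp add: affine_sym_iff)
    have "x \<otimes>\<^bsub>BijGroup UNIV\<^esub> w = id" "w \<otimes>\<^bsub>BijGroup UNIV\<^esub> x = id"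
      using B.l_inv[of w] B.r_inv[of w] bw unfolding x by simp_all
    then have "x \<circ> w = id" "w \<circ> x = id" using bw bx by simp_all
    moreover have "\<phi> id = id" by (simp add: \<phi>_def fun_eq_iff)
    ultimately show ?thesis using comp[OF xc, of w] comp[OF w, of x] by (metis o_bij)
  qed
  have "\<phi> \<in> hom (affine_sym s) (BijGroup UNIV)"
  proof (rule homI)
    fix v w assume vw: "v \<in> carrier (affine_sym s)" "w \<in> carrier (affine_sym s)"
    then have "v \<otimes>\<^bsub>affine_sym s\<^esub> w = v \<circ> w"
      using s by (simp add: affine_sym_def)
    then show "\<phi> (v \<otimes>\<^bsub>affine_sym s\<^esub> w) = \<phi> v \<otimes>\<^bsub>BijGroup UNIV\<^esub> \<phi> w"
      using comp vw bij by simp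
  qed (use bij in simp)
  then have "group_action (affine_sym s) UNIV \<phi>"
    by (simp add: group_action_def group_hom_def group_hom_axioms_def G group_BijGroup)
  moreover have "\<phi> (w_gen s i) = level_gen s t i" for i
    using a_iff[of _ "i - 1"] a_iff[of _ i] by (auto simp: \<phi>_def w_gen_def level_gen_def fun_eq_iff)
  ultimately show ?thesis by blast
qed

end

theory Submission
  imports Defs "HOL-Combinatorics.Permutations" "HOL-Library.Infinite_Set"
begin

text \<open>
  The stabiliser is a group of permutations of the \<open>s\<close>-set, and its order is then found by elementary
  counting.

  The subgroup generated by the \<open>v_gen\<close> consists of all affine permutations that commute with the
  reflection \<open>m \<mapsto> - 1 - m\<close> (\<open>carrier_affine_hyp\<close>): right multiplication by a suitable \<open>v_gen\<close> brings
  any nontrivial such permutation closer to the identity.  The level \<open>t\<close> action turns such a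
  permutation \<open>w\<close> into the periodic permutation that maps \<open>n * t - circ s t\<close> to
  \<open>w n * t - circ s t\<close>.  The result still commutes with the reflection and preserves every class
  modulo \<open>t\<close>, and conversely any periodic permutation with these two properties arises from exactly
  one \<open>w\<close>.

  A beta-set is recovered from its \<open>s\<close>-set, which represents every class modulo \<open>s\<close> once.  Hence
  the elements fixing the core correspond to arbitrary permutations of the \<open>s\<close>-set that preserve
  classes modulo \<open>t\<close> and commute with the involution \<open>m \<mapsto> s - 1 - m\<close> (\<open>card_StabSC\<close>).

  This involution permutes the classes modulo \<open>t\<close>.  Two distinct classes that it exchanges
  contribute a symmetric group, as the permutation of one determines that of the other.  A class of
  size \<open>2 y\<close> mapped to itself without fixed points contributes the hyperoctahedral group of order
  \<open>2 ^ y * fact y\<close> (\<open>card_equivariant_perms\<close>).  A fixed point must be \<open>(s - 1) / 2\<close>; it exists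
  exactly for odd \<open>s\<close>, and is then fixed by the whole group.  The three cases of the theorem differ
  in which classes are mapped to themselves: those of the integers \<open>i\<close> with \<open>2 i\<close> congruent to
  \<open>s - 1\<close> modulo \<open>t\<close>.
\<close>

section \<open>Beta-sets of partitions and of self-conjugate cores\<close>

lemma less_conjugate_iff:
  assumes "is_partition p"
  shows "i < conjugate p c \<longleftrightarrow> c < p i"
proof -
  have anti: "antimono p" and ex: "\<exists>N. p N \<le> c"
    using assms unfolding is_partition_def by (blast, metis le_refl zero_le)
  define N where "N = (LEAST N. p N \<le> c)"
  have N: "p N \<le> c" unfolding N_def using ex by (rule LeastI_ex)
  have *: "j < N \<longleftrightarrow> c + 1 \<le> p j" for j
  proof
    assume "j < N"
    then show "c + 1 \<le> p j"
      unfolding N_def using not_less_Least[of j "\<lambda>N. p N \<le> c"] by simp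
  next
    assume "c + 1 \<le> p j"
    then have "\<not> N \<le> j" using N antimonoD[OF anti, of N j] by linarith
    then show "j < N" by simp
  qed
  have "{j. c + 1 \<le> p j} = {..<N}" using * by blast
  then have "conjugate p c = N" by (simp only: conjugate_def card_lessThan)
  then show ?thesis using *[of i] by linarith
qed

text \<open>
  Reading the boundary of the Young diagram, each integer labels either a vertical step (a beta
  number) or a horizontal one, and the horizontal steps are indexed by the columns.
\<close>

lemma not_in_beta_set_iff:
  assumes "is_partition p"
  shows "m \<notin> beta_set p \<longleftrightarrow> (\<exists>c. m = int c - int (conjugate p c))"
proof
  assume m: "m \<notin> beta_set p"
  obtain N where N: "\<And>i. i \<ge> N \<Longrightarrow> p i = 0" using assms by (auto simp: is_partition_def)
  have ex: "\<exists>i. int (p i) - int i - 1 \<le> m"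
    using N[of "N + nat \<bar>m\<bar>"] by (intro exI[of _ "N + nat \<bar>m\<bar>"]) auto
  define i where "i = (LEAST i. int (p i) - int i - 1 \<le> m)"
  have i: "int (p i) - int i - 1 \<le> m" unfolding i_def using ex by (rule LeastI_ex)
  have i1: "int (p i) - int i - 1 < m"
    using i m unfolding beta_set_def by force
  have i2: "int (p j) - int j - 1 > m" if "j < i" for j
    using not_less_Least[of j "\<lambda>i. int (p i) - int i - 1 \<le> m"] that by (simp add: i_def)
  define c where "c = nat (m + int i)"
  have c: "int c = m + int i" using i1 by (simp add: c_def)
  have "\<not> i < conjugate p c" using c i1 less_conjugate_iff[OF assms, of i c] by simp
  moreover have "i - 1 < conjugate p c" if "i > 0"
    using that c i2[of "i - 1"] less_conjugate_iff[OF assms, of "i - 1" c] by auto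
  ultimately have "conjugate p c = i" by linarith
  then show "\<exists>c. m = int c - int (conjugate p c)" using c by (intro exI[of _ c]) simp
next
  assume "\<exists>c. m = int c - int (conjugate p c)"
  then obtain c where c: "m = int c - int (conjugate p c)" by blast
  have "m \<noteq> int (p i) - int (i + 1)" for i
    using less_conjugate_iff[OF assms, of i c] c by linarith
  then show "m \<notin> beta_set p" by (auto simp: beta_set_def)
qed

lemma beta_set_self_conjugate:
  assumes "is_partition p" and "conjugate p = p"
  shows "- 1 - m \<in> beta_set p \<longleftrightarrow> m \<notin> beta_set p"
proof -
  have flip: "- 1 - m = int (p c) - int (c + 1) \<longleftrightarrow> m = int c - int (p c)" for c
    by linarith
  have "- 1 - m \<in> beta_set p \<longleftrightarrow> (\<exists>c. m = int c - int (p c))"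
    unfolding beta_set_def by (simp only: mem_Collect_eq flip simp_thms)
  then show ?thesis unfolding not_in_beta_set_iff[OF assms(1), of m] assms(2) .
qed

text \<open>
  If \<open>m\<close> is the step ending row \<open>r\<close> and \<open>m - s\<close> is the step below column \<open>c\<close>, then the hook at
  \<open>(r, c)\<close> has length \<open>s\<close>; so a beta-set of a core is closed under subtracting \<open>s\<close>.
\<close>

lemma beta_set_core_diff:
  assumes p: "p \<in> cores s" and s: "s > 0" and m: "m \<in> beta_set p"
  shows "m - s \<in> beta_set p"
proof (rule ccontr)
  have part: "is_partition p" using p by (simp add: cores_def)
  assume "m - s \<notin> beta_set p"
  then obtain c where c: "m - s = int c - int (conjugate p c)"
    using not_in_beta_set_iff[OF part] by blast
  obtain r where r: "m = int (p r) - int (r + 1)" using m by (auto simp: beta_set_def)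
  have "c < p r" using less_conjugate_iff[OF part, of r c] c r s by linarith
  moreover have "hook_length p r c = s" using c r by (simp add: hook_length_def)
  ultimately show False using p by (auto simp: cores_def)
qed

lemma beta_set_bounds:
  assumes "is_partition p"
  obtains N where "\<And>m. m \<in> beta_set p \<Longrightarrow> m < N" and "\<And>m. m < - N \<Longrightarrow> m \<in> beta_set p"
proof -
  obtain N where anti: "antimono p" and N: "\<And>i. i \<ge> N \<Longrightarrow> p i = 0"
    using assms by (auto simp: is_partition_def)
  show thesis
  proof (rule that[of "int (p 0) + int N"])
    fix m
    show "m < int (p 0) + int N" if m: "m \<in> beta_set p"
    proof -
      obtain i where "m = int (p i) - int (i + 1)" using m unfolding beta_set_def by blast
      then show ?thesis using antimonoD[OF anti, of 0 i] by simp
    qed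
    assume "m < - (int (p 0) + int N)"
    then have "m = int (p (nat (- m - 1))) - int (nat (- m - 1) + 1)"
      using N[of "nat (- m - 1)"] by simp
    then show "m \<in> beta_set p" unfolding beta_set_def by blast
  qed
qed

text \<open>
  A beta-set determines its partition, because row \<open>i\<close> gives the element exceeded by exactly \<open>i\<close>
  others.
\<close>

lemma beta_set_inj:
  assumes "is_partition p" and "is_partition q" and "beta_set p = beta_set q"
  shows "p = q"
proof -
  have range: "beta_set r = range (\<lambda>i. int (r i) - int (i + 1))" for r
    by (auto simp: beta_set_def)
  have anti: "r j \<le> r i" if "is_partition r" "i \<le> j" for r :: "nat \<Rightarrow> nat" and i j
    using that by (auto simp: is_partition_def antimono_def)
  have count: "card {m \<in> beta_set r. m > int (r i) - int (i + 1)} = i" if r: "is_partition r" for r i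
  proof -
    have "{m \<in> beta_set r. m > int (r i) - int (i + 1)} = (\<lambda>j. int (r j) - int (j + 1)) ` {..<i}"
    proof (intro Set.set_eqI iffI)
      fix m assume "m \<in> {m \<in> beta_set r. m > int (r i) - int (i + 1)}"
      then obtain j where "m = int (r j) - int (j + 1)" "m > int (r i) - int (i + 1)"
        by (auto simp: beta_set_def)
      then show "m \<in> (\<lambda>j. int (r j) - int (j + 1)) ` {..<i}"
        using anti[OF r, of i j] by (cases "j < i") auto
    next
      fix m assume "m \<in> (\<lambda>j. int (r j) - int (j + 1)) ` {..<i}"
      then obtain j where j: "m = int (r j) - int (j + 1)" "j < i" by auto
      then have "m > int (r i) - int (i + 1)" using anti[OF r, of j i] by linarith
      then show "m \<in> {m \<in> beta_set r. m > int (r i) - int (i + 1)}"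
        using j(1) unfolding beta_set_def by blast
    qed
    moreover have "inj (\<lambda>j. int (r j) - int (j + 1))"
    proof (rule injI)
      fix j k assume "int (r j) - int (j + 1) = int (r k) - int (k + 1)"
      then show "j = k" using anti[OF r, of j k] anti[OF r, of k j] by linarith
    qed
    ultimately show ?thesis by (simp add: card_image inj_on_subset)
  qed
  show ?thesis
  proof
    fix i
    have "int (p i) - int (i + 1) \<in> beta_set q" using assms(3) unfolding beta_set_def by blast
    then obtain j where j: "int (p i) - int (i + 1) = int (q j) - int (j + 1)"
      unfolding beta_set_def by blast
    have "i = j"
      using count[OF assms(1), of i] count[OF assms(2), of j] unfolding j assms(3) by simp
    then show "p i = q i" using j by simp
  qed
qed

text \<open>
  A set that is bounded above and contains all sufficiently small integers is, up to translation,
  a beta-set: list it decreasingly as \<open>b 0 > b 1 > \<dots>\<close> and take the rows \<open>b i + i + 1\<close>.  The symmetry fixes the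
  translation, since exactly half of every interval \<open>{- 1 - L..L}\<close> lies in the set; for large
  \<open>L\<close> this says that \<open>b L = - 1 - L\<close>, that is, that row \<open>L\<close> is empty.
\<close>

lemma symmetric_set_is_beta_set:
  fixes B :: "int set"
  assumes bound: "\<And>m. m \<in> B \<Longrightarrow> m < N" and sym: "\<And>m. - 1 - m \<in> B \<longleftrightarrow> m \<notin> B"
  shows "\<exists>q. is_partition q \<and> beta_set q = B"
proof -
  define B' where "B' = {n::nat. N - int n \<in> B}"
  have low: "m \<in> B" if "m < - N" for m
    using bound[of "- 1 - m"] sym[of m] that by auto
  have "infinite B'"
  proof
    assume "finite B'"
    then obtain k where "\<forall>n\<in>B'. n < k" using finite_nat_set_iff_bounded by blast
    moreover have "k + nat (2 * \<bar>N\<bar> + 1) \<in> B'" unfolding B'_def using low by simp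
    ultimately show False by fastforce
  qed
  define b where "b i = N - int (enumerate B' i)" for i
  have mono: "b j < b i" if "i < j" for i j
    using enumerate_mono[OF that \<open>infinite B'\<close>] by (simp add: b_def)
  have range: "range b = B"
  proof (intro Set.set_eqI iffI)
    fix m assume "m \<in> range b"
    then show "m \<in> B" using enumerate_in_set[OF \<open>infinite B'\<close>] by (auto simp: b_def B'_def)
  next
    fix m assume m: "m \<in> B"
    then have "nat (N - m) \<in> B'" using bound[OF m] by (simp add: B'_def)
    then obtain i where "enumerate B' i = nat (N - m)"
      using enumerate_Ex[OF \<open>infinite B'\<close>] by blast
    then have "m = b i" using bound[OF m] by (simp add: b_def)
    then show "m \<in> range b" by blast
  qed
  \<comment> \<open>\<open>U\<close> holds \<open>- 1 - L\<close> and the \<open>L\<close> elements above it\<close>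
  have half: "b L = - 1 - int L" if L: "int L \<ge> \<bar>N\<bar>" for L
  proof -
    define U where "U = B \<inter> {- 1 - int L..int L}"
    have U: "m \<in> U \<longleftrightarrow> m \<in> B \<and> - 1 - int L \<le> m \<and> m \<le> int L" for m
      by (simp add: U_def)
    have "(\<lambda>m. - 1 - m) ` U = {- 1 - int L..int L} - U"
    proof (intro Set.set_eqI iffI)
      fix m assume "m \<in> (\<lambda>m. - 1 - m) ` U"
      then obtain n where n: "n \<in> U" "m = - 1 - n" by blast
      then have "m \<notin> B" using sym[of n] U[of n] by blast
      then show "m \<in> {- 1 - int L..int L} - U" using n(2) U[of n] n(1) U[of m] by auto
    next
      fix m assume "m \<in> {- 1 - int L..int L} - U"
      then have "- 1 - m \<in> U" using sym[of m] U[of m] U[of "- 1 - m"] by auto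
      then show "m \<in> (\<lambda>m. - 1 - m) ` U" by (rule image_eqI[rotated]) simp
    qed
    moreover have "inj_on (\<lambda>m::int. - 1 - m) U" by (simp add: inj_on_def)
    ultimately have "card U = card ({- 1 - int L..int L} - U)" by (metis card_image)
    also have "\<dots> = 2 * (L + 1) - card U"
      by (subst card_Diff_subset) (auto simp: U_def)
    finally have "card U = L + 1"
      using card_mono[of "{- 1 - int L..int L}" U] by (auto simp: U_def)
    moreover have "- 1 - int L \<in> U" using low L by (simp add: U_def)
    ultimately have "card (U - {- 1 - int L}) = L" by simp
    moreover have "- 1 - int L \<in> range b" using range low[of "- 1 - int L"] L by simp
    then obtain i where i: "b i = - 1 - int L" by (metis imageE)
    moreover have "U - {- 1 - int L} = b ` {..<i}"
    proof (intro Set.set_eqI iffI)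
      fix m assume m: "m \<in> U - {- 1 - int L}"
      then obtain j where j: "m = b j" using range by (auto simp: U_def)
      then have "b i < b j" using m i by (auto simp: U_def)
      then have "j < i" using mono[of i j] by (metis less_irrefl less_trans nat_neq_iff)
      then show "m \<in> b ` {..<i}" using j by blast
    next
      fix m assume "m \<in> b ` {..<i}"
      then have "m > b i" "m \<in> B" using mono range by auto
      then show "m \<in> U - {- 1 - int L}" using i bound[of m] L by (auto simp: U_def)
    qed
    moreover have "inj b" using mono by (metis injI less_irrefl nat_neq_iff)
    ultimately have "L = i" by (simp add: card_image inj_on_subset)
    then show ?thesis using i by simp
  qed
  have step: "b j + int j \<le> b i + int i" if "i \<le> j" for i j
    using that
  proof (induction rule: dec_induct)
    case (step n)
    then show ?case using mono[of n "Suc n"] by simp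
  qed simp
  have nonneg: "b i + int i + 1 \<ge> 0" for i
    using step[of i "i + nat \<bar>N\<bar>"] half[of "i + nat \<bar>N\<bar>"] by simp
  define q where "q i = nat (b i + int i + 1)" for i
  have q: "int (q i) = b i + int i + 1" for i using nonneg by (simp add: q_def)
  have "antimono q" using step by (auto simp: antimono_def q_def intro: nat_mono)
  moreover have "q i = 0" if "i \<ge> nat \<bar>N\<bar>" for i using half[of i] that by (simp add: q_def)
  ultimately have "is_partition q" by (auto simp: is_partition_def)
  moreover have "beta_set q = B" unfolding range[symmetric] beta_set_def by (auto simp: q)
  ultimately show ?thesis by blast
qed

section \<open>Periodic reflections and symmetric affine permutations\<close>

text \<open>
  The product of the transpositions \<open>(a + k s, b + k s)\<close> over all integers \<open>k\<close>.  The generators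
  \<open>w_gen\<close> and their images under the level \<open>t\<close> action have this form, and each \<open>v_gen\<close> is one such
  reflection or a product of two commuting ones.
\<close>

definition reflection :: "int \<Rightarrow> int \<Rightarrow> int \<Rightarrow> int \<Rightarrow> int" where
  "reflection s a b m =
     (if [m = a] (mod s) then m + (b - a) else if [m = b] (mod s) then m - (b - a) else m)"

lemma cong_iff_diff_eq:
  fixes m a n b s :: int
  assumes "m - a = n - b"
  shows "[m = a] (mod s) \<longleftrightarrow> [n = b] (mod s)"
  using assms by (simp add: cong_iff_dvd_diff)

lemma cong_iff_diff_eq_swap:
  fixes m a n b s :: int
  assumes "m - a = b - n"
  shows "[m = a] (mod s) \<longleftrightarrow> [n = b] (mod s)"
  using assms by (metis cong_iff_dvd_diff dvd_minus_iff minus_diff_eq)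

lemma w_gen_eq_reflection: "w_gen s i = reflection s (i - 1) i"
  by (simp add: fun_eq_iff w_gen_def reflection_def)

lemma level_gen_eq_reflection:
  "level_gen s t i = reflection s ((i - 1) * t - circ s t) (i * t - circ s t)"
  by (simp add: fun_eq_iff level_gen_def reflection_def algebra_simps)

lemma reflection_left: "[m = a] (mod s) \<Longrightarrow> reflection s a b m = m + (b - a)"
  by (simp add: reflection_def)

lemma reflection_right:
  "[m = b] (mod s) \<Longrightarrow> \<not> [a = b] (mod s) \<Longrightarrow> reflection s a b m = m - (b - a)"
  by (auto simp: reflection_def dest: cong_trans cong_sym)

lemma reflection_fixed:
  "\<not> [m = a] (mod s) \<Longrightarrow> \<not> [m = b] (mod s) \<Longrightarrow> reflection s a b m = m"
  by (simp add: reflection_def)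

lemma reflection_cases:
  obtains (left) "[m = a] (mod s)" "reflection s a b m = m + (b - a)"
  | (right) "[m = b] (mod s)" "\<not> [m = a] (mod s)" "reflection s a b m = m - (b - a)"
  | (fixed) "\<not> [m = a] (mod s)" "\<not> [m = b] (mod s)" "reflection s a b m = m"
  by (metis reflection_def)

lemma reflection_involution:
  assumes "\<not> [a = b] (mod s)"
  shows "reflection s a b (reflection s a b m) = m"
proof (cases rule: reflection_cases[of m a s b])
  case left
  have "[m + (b - a) = b] (mod s)" using left(1) by (simp add: cong_iff_dvd_diff algebra_simps)
  then show ?thesis using left(2) reflection_right[OF _ assms] by simp
next
  case right
  have "[m - (b - a) = a] (mod s)" using right(1) by (simp add: cong_iff_dvd_diff algebra_simps)
  then show ?thesis using right(3) reflection_left by simp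
next
  case fixed
  then show ?thesis by simp
qed

lemma reflection_shift: "reflection s a b (m + s) = reflection s a b m + s"
  by (simp add: reflection_def cong_def)

lemma reflection_negate:
  assumes "a' = - 1 - a" and "b' = - 1 - b"
  shows "reflection s a b (- 1 - m) = - 1 - reflection s a' b' m"
  unfolding assms
  using cong_iff_diff_eq_swap[of "- 1 - m" a "- 1 - a" m s] cong_iff_diff_eq_swap[of "- 1 - m" b "- 1 - b" m s]
  by (simp add: reflection_def cong_sym_eq[of m])

lemma reflection_swap:
  "\<not> [a = b] (mod s) \<Longrightarrow> reflection s a b = reflection s b a"
  by (auto simp: reflection_def fun_eq_iff dest: cong_trans cong_sym)

lemma reflection_cong:
  assumes "[a = a'] (mod s)" and "b - a = b' - a'"
  shows "reflection s a b = reflection s a' b'"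
proof
  fix m
  have "b - b' = a - a'" using assms(2) by simp
  then have "[b = b'] (mod s)" using assms(1) by (simp add: cong_iff_dvd_diff)
  then show "reflection s a b m = reflection s a' b' m"
    using assms by (simp add: reflection_def cong_def)
qed

lemma not_cong_small:
  fixes a b s :: int
  assumes "a \<noteq> b" and "\<bar>a - b\<bar> < s"
  shows "\<not> [a = b] (mod s)"
  using assms zdvd_not_zless[of "\<bar>a - b\<bar>" s] by (simp add: cong_iff_dvd_diff)

text \<open>
  This turns out to be the group generated by the \<open>v_gen\<close>: the affine permutations commuting with
  the reflection \<open>m \<mapsto> - 1 - m\<close>, under which the beta-set of a self-conjugate partition and its
  complement change places.
\<close>

definition symmetric_perms :: "int \<Rightarrow> (int \<Rightarrow> int) set" where
  "symmetric_perms s = {w. bij w \<and> (\<forall>m. w (m + s) = w m + s) \<and> (\<forall>m. w (- 1 - m) = - 1 - w m)}"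

lemma symmetric_permsD:
  assumes "w \<in> symmetric_perms s"
  shows "bij w" "w (m + s) = w m + s" "w (- 1 - m) = - 1 - w m"
  using assms by (auto simp: symmetric_perms_def)

lemma symmetric_perms_comp:
  "v \<in> symmetric_perms s \<Longrightarrow> w \<in> symmetric_perms s \<Longrightarrow> v \<circ> w \<in> symmetric_perms s"
  by (simp add: symmetric_perms_def bij_comp)

lemma symmetric_perms_inv:
  assumes "w \<in> symmetric_perms s"
  shows "inv_into UNIV w \<in> symmetric_perms s"
proof -
  note w = symmetric_permsD[OF assms]
  have eq: "inv_into UNIV w m = n" if "w n = m" for m n
    using that w(1) by (metis bij_is_inj inv_f_f)
  have wi: "w (inv_into UNIV w m) = m" for m
    using w(1) by (simp add: bij_is_surj surj_f_inv_f)
  have "inv_into UNIV w (m + s) = inv_into UNIV w m + s" for m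
    by (rule eq) (simp add: w wi)
  moreover have "inv_into UNIV w (- 1 - m) = - 1 - inv_into UNIV w m" for m
    by (rule eq) (simp add: w wi)
  ultimately show ?thesis using w(1) by (simp add: symmetric_perms_def bij_imp_bij_inv)
qed

text \<open>
  The condition on the sum of values is automatic, because opposite displacements cancel in pairs.
\<close>

lemma symmetric_perms_sub_affine:
  assumes "s > 0"
  shows "symmetric_perms s \<subseteq> carrier (affine_sym s)"
proof
  fix w assume "w \<in> symmetric_perms s"
  note w = symmetric_permsD[OF this]
  have d: "w (s - 1 - m) - (s - 1 - m) = - (w m - m)" for m
    using w(2)[of "- 1 - m"] w(3)[of m] by (simp add: algebra_simps)
  have "(\<Sum>m = 0..s - 1. w m - m) = (\<Sum>m = 0..s - 1. w (s - 1 - m) - (s - 1 - m))"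
    by (rule sum.reindex_bij_witness[of _ "\<lambda>m. s - 1 - m" "\<lambda>m. s - 1 - m"]) auto
  also have "\<dots> = - (\<Sum>m = 0..s - 1. w m - m)" unfolding d by (rule sum_negf)
  finally have "(\<Sum>m = 0..s - 1. w m - m) = 0" by simp
  then show "w \<in> carrier (affine_sym s)" using w assms by (simp add: affine_sym_iff)
qed

text \<open>
  Reindexing by the involution itself shows that its total displacement equals its own negative.
\<close>

lemma reflection_in_affine_sym:
  assumes "s > 0" and "\<not> [a = b] (mod s)"
  shows "reflection s a b \<in> carrier (affine_sym s)"
proof -
  let ?w = "reflection s a b"
  have bij: "bij ?w"
    using reflection_involution[OF assms(2)] by (intro o_bij[of ?w]) (auto simp: fun_eq_iff)
  have "(\<Sum>m = 0..s - 1. ?w m - m) = (\<Sum>m = 0..s - 1. ?w (?w m) - ?w m)"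
    using sum_periodic_reindex[of s ?w "\<lambda>m. ?w m - m"] displacement_cong[of ?w s]
      reflection_shift assms(1) bij by (simp add: bij_is_inj)
  also have "\<dots> = - (\<Sum>m = 0..s - 1. ?w m - m)"
    unfolding reflection_involution[OF assms(2)] by (simp flip: sum_negf)
  finally show ?thesis using assms(1) bij reflection_shift by (simp add: affine_sym_iff)
qed

lemma w_gen_in_affine_sym: "s \<ge> 2 \<Longrightarrow> w_gen s i \<in> carrier (affine_sym s)"
  unfolding w_gen_eq_reflection by (rule reflection_in_affine_sym, simp, rule not_cong_small) auto

lemma reflection_compose_disjoint:
  assumes "\<not> [a = c] (mod s)" "\<not> [a = d] (mod s)" "\<not> [b = c] (mod s)" "\<not> [b = d] (mod s)"
  shows "reflection s a b (reflection s c d m) =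
    (if [m = a] (mod s) \<or> [m = b] (mod s) then reflection s a b m else reflection s c d m)"
proof (cases "[m = a] (mod s) \<or> [m = b] (mod s)")
  case True
  then have "reflection s c d m = m"
    using assms by (intro reflection_fixed) (auto simp: cong_def)
  then show ?thesis using True by simp
next
  case False
  have "[reflection s c d m = c] (mod s) \<or> [reflection s c d m = d] (mod s) \<or> reflection s c d m = m"
  proof (cases rule: reflection_cases[of m c s d])
    case left
    have "[m + (d - c) = d] (mod s)" using left(1) by (simp add: cong_iff_dvd_diff algebra_simps)
    then show ?thesis using left(2) by simp
  next
    case right
    have "[m - (d - c) = c] (mod s)" using right(1) by (simp add: cong_iff_dvd_diff algebra_simps)
    then show ?thesis using right(3) by simp
  qed simp
  then have "\<not> [reflection s c d m = a] (mod s) \<and> \<not> [reflection s c d m = b] (mod s)"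
    using False assms by (auto simp: cong_def)
  then show ?thesis using False by (simp add: reflection_fixed)
qed

text \<open>
  The braid relation, in the form in which both sides are the reflection in the outer classes.
\<close>

lemma reflection_braid:
  assumes "s \<ge> 3"
  shows "reflection s (j - 1) j (reflection s j (j + 1) (reflection s (j - 1) j m))
      = reflection s (j - 1) (j + 1) m" (is "?f m = ?h m")
    and "reflection s j (j + 1) (reflection s (j - 1) j (reflection s j (j + 1) m))
      = reflection s (j - 1) (j + 1) m" (is "?g m = ?h m")
proof -
  have ne: "\<not> [j - 1 = j] (mod s)" "\<not> [j - 1 = j + 1] (mod s)" "\<not> [j = j + 1] (mod s)"
    "\<not> [j = j - 1] (mod s)" "\<not> [j + 1 = j - 1] (mod s)" "\<not> [j + 1 = j] (mod s)"
    using assms by (intro not_cong_small; simp)+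
  have f: "?f m = m + (?f n - n)" and g: "?g m = m + (?g n - n)" and h: "?h m = m + (?h n - n)"
    if "[m = n] (mod s)" for n
    using displacement_cong[OF _ that, of ?f] displacement_cong[OF _ that, of ?g]
      displacement_cong[OF _ that, of ?h] by (simp_all add: reflection_shift)
  consider "[m = j - 1] (mod s)" | "[m = j] (mod s)" | "[m = j + 1] (mod s)"
    | "\<not> [m = j - 1] (mod s)" "\<not> [m = j] (mod s)" "\<not> [m = j + 1] (mod s)"
    by blast
  then have "?f m = ?h m \<and> ?g m = ?h m"
  proof cases
    case 1
    show ?thesis unfolding f[OF 1] g[OF 1] h[OF 1] by (simp add: reflection_def ne)
  next
    case 2
    show ?thesis unfolding f[OF 2] g[OF 2] h[OF 2] by (simp add: reflection_def ne)
  next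
    case 3
    show ?thesis unfolding f[OF 3] g[OF 3] h[OF 3] by (simp add: reflection_def ne)
  next
    case 4
    then show ?thesis by (simp add: reflection_fixed)
  qed
  then show "?f m = ?h m" "?g m = ?h m" by blast+
qed

text \<open>
  Three shapes occur.  When \<open>2 i = 0\<close> modulo \<open>s\<close>, the reflection \<open>w_gen s i\<close> is already symmetric.
  Generically \<open>w_gen s i\<close> and its mirror image move disjoint classes.  For odd \<open>s\<close> there is a class
  \<open>j\<close> fixed by \<open>m \<mapsto> - 1 - m\<close>; if it is that of \<open>i\<close> or \<open>- i\<close>, then both \<open>w_gen s i\<close> and its mirror image
  move it, and the braid relation turns \<open>v_gen s i\<close> into the reflection exchanging its neighbours.
\<close>

lemma v_gen_cases [consumes 1, case_names special pair centre]:
  assumes s: "s \<ge> 2"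
  obtains (special) "[2 * i = 0] (mod s)" "v_gen s i = reflection s (i - 1) i"
  | (pair) "\<not> [i - 1 = - i] (mod s)" "\<not> [i - 1 = - i - 1] (mod s)" "\<not> [i = - i] (mod s)"
      "\<not> [i = - i - 1] (mod s)"
      "v_gen s i = reflection s (i - 1) i \<circ> reflection s (- i - 1) (- i)"
  | (centre) j where "j = i \<or> j = - i" "[2 * j = - 1] (mod s)" "s \<ge> 3"
      "v_gen s i = reflection s (j - 1) (j + 1)"
proof -
  define r where "r = i mod s"
  have r: "0 \<le> r" "r < s" "[i = r] (mod s)" using s by (simp_all add: r_def cong_def)
  have sub: "s dvd i - r" using r(3) by (simp add: cong_iff_dvd_diff)
  define k where "k = (i - r) div s"
  have k: "i = r + s * k" using sub by (simp add: k_def)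
  have dvd: "s dvd x \<longleftrightarrow> s dvd y" if "x - y = s * l" for x y l
  proof -
    have "x = y + s * l" using that by simp
    then show ?thesis by (simp add: dvd_add_left_iff)
  qed
  consider (zero) "r = 0" | (mid) "r \<noteq> 0" "r < s div 2 \<or> s - r < s div 2"
    | (outer) "r \<noteq> 0" "s div 2 \<le> r" "s div 2 \<le> s - r"
    by linarith
  then show thesis
  proof cases
    case zero
    then have i0: "[i = 0] (mod s)" using r by simp
    then have "[2 * i = 0] (mod s)" by (metis cong_scalar_left mult_zero_right)
    then show thesis using special i0 by (simp add: v_gen_def w_gen_eq_reflection)
  next
    case mid
    have n0: "\<not> [i = 0] (mod s)" using r mid by (metis cong_def mod_pos_pos_trivial mod_0)
    have "\<exists>l. 1 \<le> l \<and> l < s div 2 \<and> ([i = l] (mod s) \<or> [i = - l] (mod s))"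
    proof (cases "r < s div 2")
      case True
      then show ?thesis using r mid by (intro exI[of _ r]) auto
    next
      case False
      moreover have "[i = - (s - r)] (mod s)" using r(3) by (simp add: cong_def)
      ultimately show ?thesis using r mid by (intro exI[of _ "s - r"]) auto
    qed
    then have v: "v_gen s i = reflection s (i - 1) i \<circ> reflection s (- i - 1) (- i)"
      using n0 by (simp add: v_gen_def w_gen_eq_reflection)
    have "\<not> s dvd 2 * r + e" if "e \<in> {-1, 0, 1}" for e
    proof
      assume "s dvd 2 * r + e"
      then obtain l where l: "2 * r + e = s * l" by blast
      have "0 < 2 * r + e" "2 * r + e < 2 * s" "2 * r + e \<noteq> s" using that mid r by auto
      then have "0 < s * l" "s * l < s * 2" "s * l \<noteq> s * 1" using l by (auto simp: mult.commute)
      then have "0 < l" "l < 2" "l \<noteq> 1"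
        using s mult_less_cancel_left_pos[of s l 2] mult_less_cancel_left_pos[of s 0 l] by auto
      then show False by simp
    qed
    moreover have "s dvd 2 * i + e \<longleftrightarrow> s dvd 2 * r + e" for e
      by (rule dvd[of _ _ "2 * k"]) (simp add: k)
    ultimately have odd': "\<not> s dvd 2 * i + e" if "e \<in> {-1, 0, 1}" for e
      using that by blast
    have "\<not> [i - 1 = - i] (mod s)" "\<not> [i - 1 = - i - 1] (mod s)" "\<not> [i = - i] (mod s)"
      "\<not> [i = - i - 1] (mod s)"
      using odd'[of 0] odd'[of 1] odd'[of "-1"] by (simp_all add: cong_iff_dvd_diff algebra_simps)
    then show thesis using v by (rule pair)
  next
    case outer
    have n0: "\<not> [i = 0] (mod s)" using r outer by (metis cong_def mod_pos_pos_trivial mod_0)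
    have nl: "\<not> (\<exists>l. 1 \<le> l \<and> l < s div 2 \<and> ([i = l] (mod s) \<or> [i = - l] (mod s)))"
    proof safe
      fix l assume l: "1 \<le> l" "l < s div 2"
      show False if "[i = l] (mod s)"
        using that l r outer not_cong_small[of r l s] by (auto dest: cong_trans cong_sym)
      show False if "[i = - l] (mod s)"
      proof -
        have "[i = s - l] (mod s)" using that by (simp add: cong_def)
        then show False
          using l r outer not_cong_small[of r "s - l" s] by (auto dest: cong_trans cong_sym)
      qed
    qed
    have v: "v_gen s i = w_gen s i \<circ> w_gen s (- i) \<circ> w_gen s i"
      by (simp only: v_gen_def n0 nl if_False)
    have inv: "w_gen s i (w_gen s i m) = m" for m
      unfolding w_gen_eq_reflection using s by (intro reflection_involution not_cong_small) auto
    show thesis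
    proof (cases "even s")
      case True
      then have "2 * r = s" using outer by presburger
      then have i2: "[2 * i = 0] (mod s)" using k by (simp add: cong_iff_dvd_diff)
      have "w_gen s (- i) = w_gen s i"
        unfolding w_gen_eq_reflection
        using i2 cong_iff_diff_eq_swap[of "2 * i" 0 "i - 1" "- i - 1" s] by (intro reflection_cong) auto
      then have "v_gen s i = reflection s (i - 1) i"
        unfolding v using inv by (simp add: fun_eq_iff flip: w_gen_eq_reflection)
      then show thesis using special i2 by blast
    next
      case False
      then have s3: "s \<ge> 3" using s by presburger
      from False outer have "2 * r + 1 = s \<or> 2 * r - 1 = s" by presburger
      then show thesis
      proof
        assume r1: "2 * r + 1 = s"
        have "2 * i + 1 = s * (1 + 2 * k)" using k r1 by (simp add: algebra_simps)
        then have i2: "[2 * i = - 1] (mod s)" by (simp add: cong_iff_dvd_diff)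
        have "w_gen s (- i) = reflection s i (i + 1)"
          unfolding w_gen_eq_reflection
          using i2 cong_iff_diff_eq_swap[of "2 * i" "- 1" i "- i - 1" s] by (intro reflection_cong) auto
        then have "v_gen s i = reflection s (i - 1) (i + 1)"
          unfolding v using reflection_braid(1)[OF s3] by (simp add: fun_eq_iff w_gen_eq_reflection)
        then show thesis using centre[of i] i2 s3 by blast
      next
        assume r1: "2 * r - 1 = s"
        have "2 * (- i) + 1 = s * (- 1 - 2 * k)" using k r1 by (simp add: algebra_simps)
        then have i2: "[2 * (- i) = - 1] (mod s)" by (simp add: cong_iff_dvd_diff)
        have "w_gen s i = reflection s (- i) (- i + 1)"
          unfolding w_gen_eq_reflection
          using i2 cong_iff_diff_eq_swap[of "2 * (- i)" "- 1" "- i" "i - 1" s] by (intro reflection_cong) auto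
        then have "v_gen s i = reflection s (- i - 1) (- i + 1)"
          unfolding v using reflection_braid(2)[OF s3, of "- i"] by (simp add: fun_eq_iff w_gen_eq_reflection)
        then show thesis using centre[of "- i"] i2 s3 by blast
      qed
    qed
  qed
qed

section \<open>The generators of the hyperoctahedral subgroup\<close>

lemma v_gen_symmetric:
  assumes s: "s \<ge> 2"
  shows v_gen_in_symmetric_perms: "v_gen s i \<in> symmetric_perms s"
    and v_gen_involution: "v_gen s i (v_gen s i m) = m"
proof -
  have gen: "f \<in> symmetric_perms s" if "\<And>m. f (f m) = m" "\<And>m. f (m + s) = f m + s"
    "\<And>m. f (- 1 - m) = - 1 - f m" for f
    using that o_bij[of f f] by (simp add: symmetric_perms_def fun_eq_iff)
  have "(\<forall>m. v_gen s i (v_gen s i m) = m) \<and> (\<forall>m. v_gen s i (m + s) = v_gen s i m + s)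
      \<and> (\<forall>m. v_gen s i (- 1 - m) = - 1 - v_gen s i m)"
  using s proof (cases rule: v_gen_cases[of s i])
    case special
    have ne: "\<not> [i - 1 = i] (mod s)" "\<not> [- i = - i - 1] (mod s)"
      using s by (intro not_cong_small; simp)+
    have "reflection s (- i) (- i - 1) = reflection s (- i - 1) (- i)"
      by (rule reflection_swap[OF ne(2)])
    also have "\<dots> = reflection s (i - 1) i"
      using special(1) cong_iff_diff_eq_swap[of "2 * i" 0 "i - 1" "- i - 1" s]
      by (intro reflection_cong) auto
    finally show ?thesis unfolding special(2)
      using reflection_involution[OF ne(1)] reflection_shift[of s "i - 1" i]
        reflection_negate[of "- i" "i - 1" "- i - 1" i s] by simp
  next
    case pair
    let ?f = "reflection s (i - 1) i" and ?g = "reflection s (- i - 1) (- i)"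
    have ne: "\<not> [i - 1 = i] (mod s)" "\<not> [- i = - i - 1] (mod s)" "\<not> [- i - 1 = - i] (mod s)"
      "\<not> [i = i - 1] (mod s)"
      using s by (intro not_cong_small; simp)+
    have f: "?f (- 1 - m) = - 1 - ?g m" for m
      using reflection_negate[of "- i" "i - 1" "- i - 1" i s m] reflection_swap[OF ne(2)] by simp
    have g: "?g (- 1 - m) = - 1 - ?f m" for m
      using reflection_negate[of i "- i - 1" "i - 1" "- i" s m] reflection_swap[OF ne(4)] by simp
    have comm: "?f (?g m) = ?g (?f m)" for m
    proof -
      have "reflection s (i - 1) i m = m"
        if "\<not> ([m = i - 1] (mod s) \<or> [m = i] (mod s))" using that by (simp add: reflection_fixed)
      moreover have "?g m = m"
        if "\<not> ([m = - i - 1] (mod s) \<or> [m = - i] (mod s))" using that by (simp add: reflection_fixed)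
      moreover have "\<not> (([m = i - 1] (mod s) \<or> [m = i] (mod s)) \<and>
          ([m = - i - 1] (mod s) \<or> [m = - i] (mod s)))"
        using pair(1-4) by (auto simp: cong_def)
      moreover have "\<not> [- i - 1 = i - 1] (mod s)" "\<not> [- i - 1 = i] (mod s)"
        "\<not> [- i = i - 1] (mod s)" "\<not> [- i = i] (mod s)"
        using pair(1-4) by (auto dest: cong_sym)
      ultimately show ?thesis
        using pair(1-4) reflection_compose_disjoint[of "i - 1" "- i - 1" s "- i" i m]
          reflection_compose_disjoint[of "- i - 1" "i - 1" s i "- i" m]
        by auto
    qed
    show ?thesis unfolding pair(5)
      using reflection_involution[OF ne(1)] reflection_involution[OF ne(3)]
        reflection_shift[of s "i - 1" i] reflection_shift[of s "- i - 1" "- i"] f g comm by simp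
  next
    case (centre j)
    have ne: "\<not> [j - 1 = j + 1] (mod s)" "\<not> [- j = - j - 2] (mod s)"
      using centre(3) by (intro not_cong_small; simp)+
    have "reflection s (- j) (- j - 2) = reflection s (- j - 2) (- j)"
      by (rule reflection_swap[OF ne(2)])
    also have "\<dots> = reflection s (j - 1) (j + 1)"
      using centre(2) cong_iff_diff_eq_swap[of "2 * j" "- 1" "j - 1" "- j - 2" s]
      by (intro reflection_cong) auto
    finally show ?thesis unfolding centre(4)
      using reflection_involution[OF ne(1)] reflection_shift[of s "j - 1" "j + 1"]
        reflection_negate[of "- j" "j - 1" "- j - 2" "j + 1" s] by simp
  qed
  then show "v_gen s i \<in> symmetric_perms s" "v_gen s i (v_gen s i m) = m"
    using gen[of "v_gen s i"] by blast+
qed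

text \<open>
  Periodicity and symmetry propagate the descent of \<open>w\<close> at \<open>(i - 1, i)\<close> to all pairs
  \<open>{m, v_gen s i m}\<close> of distinct elements: each of them is an inversion of \<open>w\<close>, which is what
  positivity of the product expresses.
\<close>

lemma v_gen_descent:
  assumes s: "s \<ge> 2" and w: "w \<in> symmetric_perms s" and desc: "w i < w (i - 1)"
  shows "(v_gen s i m - m) * (w m - w (v_gen s i m)) \<ge> 0"
    and "\<exists>m. (v_gen s i m - m) * (w m - w (v_gen s i m)) > 0"
proof -
  note wD = symmetric_permsD[OF w]
  have per: "w m - w n = w a - w b" if "[m = a] (mod s)" "m - a = n - b" for m n a b
  proof -
    have "[n = b] (mod s)" using that cong_iff_diff_eq by blast
    then have "w n - n = w b - b" "w m - m = w a - a"
      using displacement_cong[of w s] wD(2) that(1) by blast+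
    then show ?thesis using that(2) by simp
  qed
  have neg: "w (- 1 - m) = - 1 - w m" for m by (rule wD(3))
  have "w (- i) = - 1 - w (i - 1)" "w (- i - 1) = - 1 - w i"
    using neg[of "i - 1"] neg[of i] arg_cong[of "- i - 1" "- 1 - i" w] by simp_all
  then have mirror: "w (- i) < w (- i - 1)" using desc by simp
  have refl: "(reflection s a b m - m) * (w m - w (reflection s a b m)) \<ge> 0"
    if "a < b" "w b < w a" for a b m
  proof (cases rule: reflection_cases[of m a s b])
    case left
    then show ?thesis using that per[of m a "m + (b - a)" b] by simp
  next
    case right
    then show ?thesis
      using that per[of m b "m - (b - a)" a] by (simp add: mult_nonpos_nonpos)
  qed simp
  have pos: "\<exists>m. (v_gen s i m - m) * (w m - w (v_gen s i m)) > 0"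
    if "v_gen s i a = b" "a < b" "w b < w a" for a b
    by (rule exI[of _ a]) (simp add: that)
  have "(\<forall>m. (v_gen s i m - m) * (w m - w (v_gen s i m)) \<ge> 0)
      \<and> (\<exists>m. (v_gen s i m - m) * (w m - w (v_gen s i m)) > 0)"
  using s proof (cases rule: v_gen_cases[of s i])
    case special
    have "v_gen s i (i - 1) = i" unfolding special(2) by (simp add: reflection_left)
    then have "\<exists>m. (v_gen s i m - m) * (w m - w (v_gen s i m)) > 0" by (rule pos) (simp_all add: desc)
    moreover have "\<forall>m. (v_gen s i m - m) * (w m - w (v_gen s i m)) \<ge> 0"
      unfolding special(2) using refl[OF _ desc] by simp
    ultimately show ?thesis by blast
  next
    case pair
    let ?f = "reflection s (i - 1) i" and ?g = "reflection s (- i - 1) (- i)"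
    have nn: "(?f m - m) * (w m - w (?f m)) \<ge> 0" "(?g m - m) * (w m - w (?g m)) \<ge> 0" for m
      using refl desc mirror by simp_all
    have "v_gen s i m = ?f m \<or> v_gen s i m = ?g m" for m
      unfolding pair(5) using pair(1-4) by (simp add: reflection_compose_disjoint)
    then have "\<forall>m. (v_gen s i m - m) * (w m - w (v_gen s i m)) \<ge> 0" using nn by metis
    moreover have "v_gen s i (i - 1) = i"
      unfolding pair(5) using pair(1-4) reflection_left[of "i - 1" "i - 1" s i]
      by (simp add: reflection_compose_disjoint)
    then have "\<exists>m. (v_gen s i m - m) * (w m - w (v_gen s i m)) > 0" by (rule pos) (simp_all add: desc)
    ultimately show ?thesis by blast
  next
    case (centre j)
    have refl_sym: "w (j - 1) + w (j + 1) = 2 * w j"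
    proof -
      have "2 * j - (- 1) = j - (- 1 - j)" by simp
      then have c: "[- 1 - j = j] (mod s)" using centre(2) cong_iff_diff_eq_swap by blast
      have "w (- 1 - j) - w (- 1 - (j + 1)) = w j - w (j - 1)" by (rule per[OF c]) simp
      then show ?thesis using neg[of j] neg[of "j + 1"] by linarith
    qed
    moreover have "w j < w (j - 1)"
      using centre(1) desc mirror by auto
    ultimately have less: "w (j + 1) < w (j - 1)" by simp
    have "v_gen s i (j - 1) = j + 1" unfolding centre(4) by (simp add: reflection_left)
    then have "\<exists>m. (v_gen s i m - m) * (w m - w (v_gen s i m)) > 0" by (rule pos) (simp_all add: less)
    moreover have "\<forall>m. (v_gen s i m - m) * (w m - w (v_gen s i m)) \<ge> 0"
      unfolding centre(4) using refl[OF _ less] by simp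
    ultimately show ?thesis by blast
  qed
  then show "(v_gen s i m - m) * (w m - w (v_gen s i m)) \<ge> 0"
    "\<exists>m. (v_gen s i m - m) * (w m - w (v_gen s i m)) > 0" by blast+
qed

definition spread :: "int \<Rightarrow> (int \<Rightarrow> int) \<Rightarrow> int" where
  "spread s w = (\<Sum>m = 0..s - 1. (w m - m)\<^sup>2)"

text \<open>
  By the rearrangement inequality, undoing inversions brings the values closer to their positions.
  Summing over each pair \<open>{m, x m}\<close> twice, for \<open>x = v_gen s i\<close>, gives
  \<open>2 (spread s w - spread s (w \<circ> x)) = \<Sum>m. 2 (x m - m) (w m - w (x m))\<close>, and all terms on the
  right are nonnegative.
\<close>

lemma spread_decreases:
  assumes s: "s \<ge> 2" and w: "w \<in> symmetric_perms s" and desc: "w i < w (i - 1)"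
  shows "spread s (w \<circ> v_gen s i) < spread s w"
proof -
  define x where "x = v_gen s i"
  note wD = symmetric_permsD[OF w]
  have x: "x \<in> symmetric_perms s" and xx: "x (x m) = m" for m
    using v_gen_symmetric[OF s] by (simp_all add: x_def)
  note xD = symmetric_permsD[OF x]
  have reindex: "(\<Sum>m = 0..s - 1. d (x m)) = (\<Sum>m = 0..s - 1. d m)"
    if "\<And>m n. [m = n] (mod s) \<Longrightarrow> d m = d n" for d :: "int \<Rightarrow> int"
    using s xD that by (intro sum_periodic_reindex) (auto simp: bij_is_inj)
  have dw: "w m - m = w n - n" and dx: "x m - m = x n - n"
    and dwx: "w (x m) - m = w (x n) - n" if "[m = n] (mod s)" for m n
  proof -
    show dw: "w m - m = w n - n" and dx: "x m - m = x n - n"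
      using that displacement_cong[of w s] displacement_cong[of x s] wD(2) xD(2) by blast+
    have "x m - x n = m - n" using dx by simp
    then have "[x m = x n] (mod s)" using that by (simp add: cong_iff_dvd_diff)
    then have "w (x m) - x m = w (x n) - x n" using displacement_cong[of w s] wD(2) by blast
    then show "w (x m) - m = w (x n) - n" using dx by simp
  qed
  define g where "g m = (x m - m) * (w m - w (x m))" for m
  have g_cong: "g m = g n" if "[m = n] (mod s)" for m n
  proof -
    have "w m - w (x m) = w n - w (x n)" using dw[OF that] dwx[OF that] by simp
    then show ?thesis using dx[OF that] by (simp add: g_def)
  qed
  have "(\<Sum>m = 0..s - 1. (w m - m)\<^sup>2) = (\<Sum>m = 0..s - 1. (w (x m) - x m)\<^sup>2)"
    using reindex[of "\<lambda>m. (w m - m)\<^sup>2"] dw by simp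
  moreover have "(\<Sum>m = 0..s - 1. (w (x m) - m)\<^sup>2) = (\<Sum>m = 0..s - 1. (w m - x m)\<^sup>2)"
    using reindex[of "\<lambda>m. (w (x m) - m)\<^sup>2"] dwx by (simp add: xx)
  ultimately have "2 * (spread s w - spread s (w \<circ> x)) =
      (\<Sum>m = 0..s - 1. (w m - m)\<^sup>2 + (w (x m) - x m)\<^sup>2 - (w (x m) - m)\<^sup>2 - (w m - x m)\<^sup>2)"
    by (simp add: spread_def sum_subtractf sum.distrib)
  also have "\<dots> = (\<Sum>m = 0..s - 1. 2 * g m)"
    by (intro sum.cong) (auto simp: g_def power2_eq_square algebra_simps)
  also have "\<dots> > 0"
  proof -
    obtain m where "g m > 0" using v_gen_descent(2)[OF assms] by (auto simp: g_def x_def)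
    then have "2 * g (m mod s) > 0" using g_cong[of m "m mod s"] by simp
    moreover have "m mod s \<in> {0..s - 1}" using s by simp
    moreover have "2 * g n \<ge> 0" for n using v_gen_descent(1)[OF assms] by (simp add: g_def x_def)
    ultimately show ?thesis by (intro sum_pos2[of _ "m mod s"]) auto
  qed
  finally show ?thesis by (simp add: x_def)
qed

text \<open>
  An increasing periodic bijection is a translation, and the symmetry only allows the trivial one.
\<close>

lemma symmetric_perm_without_descent:
  assumes s: "s \<ge> 2" and w: "w \<in> symmetric_perms s" and "\<And>i. w (i - 1) \<le> w i"
  shows "w = id"
proof -
  note wD = symmetric_permsD[OF w]
  have step: "w (i - 1) - (i - 1) \<le> w i - i" for i
  proof -
    have "w (i - 1) \<noteq> w i" using wD(1) by (simp add: bij_is_inj inj_eq)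
    then show ?thesis using assms(3)[of i] by simp
  qed
  have mono: "w i - i \<le> w (i + int n) - (i + int n)" for i n
  proof (induction n)
    case (Suc n)
    then show ?case using step[of "i + int (Suc n)"] by (simp add: algebra_simps)
  qed simp
  have const: "w (i - 1) - (i - 1) = w i - i" for i
    using step[of i] mono[of i "nat (s - 1)"] wD(2)[of "i - 1"] s by (simp add: algebra_simps)
  have translation: "w i - i = w 0" for i
  proof (induction i rule: int_induct[where k = 0])
    case (step1 i)
    then show ?case using const[of "i + 1"] by simp
  next
    case (step2 i)
    then show ?case using const[of i] by simp
  qed simp
  from translation[of "- 1"] wD(3)[of 0] have "w 0 = 0" by simp
  then show ?thesis using translation by (auto simp: fun_eq_iff)
qed

text \<open>
  Removing descents one at a time reaches the identity, so every symmetric permutation is a product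
  of the \<open>v_gen\<close>.
\<close>

lemma symmetric_perms_induct [consumes 2, case_names id step]:
  assumes s: "s \<ge> 2" and w: "w \<in> symmetric_perms s" and id: "P id"
    and step: "\<And>w i. w \<in> symmetric_perms s \<Longrightarrow> P w \<Longrightarrow> P (w \<circ> v_gen s i)"
  shows "P w"
  using w
proof (induction "nat (spread s w)" arbitrary: w rule: less_induct)
  case less
  show ?case
  proof (cases "\<exists>i. w i < w (i - 1)")
    case False
    then have "w = id" using symmetric_perm_without_descent[OF s less.prems] by (metis not_le)
    then show ?thesis using id by simp
  next
    case True
    then obtain i where i: "w i < w (i - 1)" by blast
    have mem: "w \<circ> v_gen s i \<in> symmetric_perms s"
      using less.prems v_gen_in_symmetric_perms[OF s] by (rule symmetric_perms_comp)
    have "spread s (w \<circ> v_gen s i) < spread s w" by (rule spread_decreases[OF s less.prems i])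
    moreover have "spread s (w \<circ> v_gen s i) \<ge> 0" unfolding spread_def by (rule sum_nonneg) simp
    ultimately have "P (w \<circ> v_gen s i)" using less.hyps[OF _ mem] by simp
    then have "P (w \<circ> v_gen s i \<circ> v_gen s i)" by (rule step[OF mem])
    moreover have "w \<circ> v_gen s i \<circ> v_gen s i = w"
      using v_gen_involution[OF s] by (simp add: fun_eq_iff)
    ultimately show ?thesis by simp
  qed
qed

section \<open>The level t action on symmetric permutations\<close>

lemma affine_sym_simps:
  assumes "s > 0"
  shows "group (affine_sym s)" and "\<one>\<^bsub>affine_sym s\<^esub> = id"
    and "v \<in> carrier (affine_sym s) \<Longrightarrow> w \<in> carrier (affine_sym s) \<Longrightarrow>
      v \<otimes>\<^bsub>affine_sym s\<^esub> w = v \<circ> w"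
proof -
  interpret B: group "BijGroup (UNIV :: int set)" by (rule group_BijGroup)
  show "group (affine_sym s)"
    using B.subgroup_imp_group[OF subgroup_affine_sym[OF assms]] by (simp add: affine_sym_def)
  show "\<one>\<^bsub>affine_sym s\<^esub> = id" by (simp add: affine_sym_def)
  show "v \<otimes>\<^bsub>affine_sym s\<^esub> w = v \<circ> w"
    if "v \<in> carrier (affine_sym s)" "w \<in> carrier (affine_sym s)"
    using that assms by (simp add: affine_sym_def)
qed

lemma carrier_affine_hyp:
  assumes s: "s \<ge> 2"
  shows "carrier (affine_hyp s) = symmetric_perms s"
proof -
  have s0: "s > 0" using s by simp
  interpret G: group "affine_sym s" using affine_sym_simps(1)[OF s0] .
  note mult = affine_sym_simps(3)[OF s0]
  have sub: "symmetric_perms s \<subseteq> carrier (affine_sym s)" by (rule symmetric_perms_sub_affine[OF s0])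
  have gens: "carrier (affine_sym s) \<inter> range (v_gen s) = range (v_gen s)"
    using v_gen_in_symmetric_perms[OF s] sub by blast
  have inv: "inv\<^bsub>affine_sym s\<^esub> w \<in> symmetric_perms s" if w: "w \<in> symmetric_perms s" for w
  proof -
    have "inv_into UNIV w \<in> symmetric_perms s" by (rule symmetric_perms_inv[OF w])
    moreover have "inv_into UNIV w \<circ> w = id"
      using symmetric_permsD(1)[OF w] by (simp add: bij_is_inj)
    moreover have "w \<in> carrier (affine_sym s)" using w sub by blast
    moreover have "inv_into UNIV w \<in> carrier (affine_sym s)" using calculation(1) sub by blast
    ultimately have "inv\<^bsub>affine_sym s\<^esub> w = inv_into UNIV w"
      using mult affine_sym_simps(2)[OF s0] by (intro G.inv_equality) simp_all
    then show ?thesis using \<open>inv_into UNIV w \<in> symmetric_perms s\<close> by simp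
  qed
  have "id \<in> symmetric_perms s" by (simp add: symmetric_perms_def)
  then have "subgroup (symmetric_perms s) (affine_sym s)"
    using sub inv mult symmetric_perms_comp by (intro G.subgroupI) (auto simp: subset_iff)
  then have "generate (affine_sym s) (range (v_gen s)) \<subseteq> symmetric_perms s"
    using v_gen_in_symmetric_perms[OF s] by (intro G.generate_subgroup_incl) auto
  moreover have "w \<in> generate (affine_sym s) (range (v_gen s))" if "w \<in> symmetric_perms s" for w
    using s that
  proof (induction rule: symmetric_perms_induct)
    case id
    then show ?case using generate.one[of "affine_sym s"] affine_sym_simps(2)[OF s0] by metis
  next
    case (step w i)
    have "w \<otimes>\<^bsub>affine_sym s\<^esub> v_gen s i \<in> generate (affine_sym s) (range (v_gen s))"
      by (rule generate.eng[OF step(2) generate.incl]) simp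
    moreover have "w \<otimes>\<^bsub>affine_sym s\<^esub> v_gen s i = w \<circ> v_gen s i"
      using step(1) v_gen_in_symmetric_perms[OF s] sub by (intro mult) auto
    ultimately show ?case by (simp only:)
  qed
  ultimately show ?thesis
    unfolding affine_hyp_def carrier_subgroup_generated gens by blast
qed

lemma level_gen_progression:
  assumes "coprime s t"
  shows "level_gen s t i (n * t - circ s t) = w_gen s i n * t - circ s t"
proof -
  have progression_cong: "[n * t - circ s t = k * t - circ s t] (mod s) \<longleftrightarrow> [n = k] (mod s)" for k
  proof -
    have "n * t - circ s t - (k * t - circ s t) = t * (n - k)" by (simp add: algebra_simps)
    then show ?thesis
      using assms by (simp add: cong_iff_dvd_diff coprime_dvd_mult_right_iff)
  qed
  show ?thesis unfolding level_gen_def w_gen_def progression_cong by (simp add: left_diff_distrib distrib_right)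
qed

text \<open>
  On the arithmetic progression \<open>n * t - circ s t\<close> the level \<open>t\<close> action copies \<open>w\<close>.  This holds
  for the generators and is inherited by products, whichever action the choice operator has picked.
\<close>

lemma level_action_symmetric_perm:
  assumes s: "s \<ge> 2" and co: "coprime s t" and w: "w \<in> symmetric_perms s"
  shows "bij (level_action s t w)"
    and "level_action s t w (m + s) = level_action s t w m + s"
    and "level_action s t w (n * t - circ s t) = w n * t - circ s t"
proof -
  have s0: "s > 0" using s by simp
  let ?G = "affine_sym s" and ?\<phi> = "level_action s t"
  have act: "group_action ?G UNIV ?\<phi>" and gen: "?\<phi> (w_gen s i) = level_gen s t i" for i
    using someI_ex[OF level_action_exists[OF s co]] unfolding level_action_def by blast+
  interpret h: group_hom ?G "BijGroup UNIV" ?\<phi> using act by (simp add: group_action_def)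
  note mult = affine_sym_simps(3)[OF s0]
  have bij: "bij (?\<phi> w)" if "w \<in> carrier ?G" for w using h.hom_closed[OF that] by simp
  have comp: "?\<phi> (v \<circ> w) = ?\<phi> v \<circ> ?\<phi> w" if "v \<in> carrier ?G" "w \<in> carrier ?G" for v w
    using h.hom_mult[OF that] mult[OF that] bij that by simp
  have closed: "v \<circ> w \<in> carrier ?G" if "v \<in> carrier ?G" "w \<in> carrier ?G" for v w
    using h.G.m_closed[OF that] mult[OF that] by simp
  define Q where "Q w \<longleftrightarrow> w \<in> carrier ?G \<and> (\<forall>m. ?\<phi> w (m + s) = ?\<phi> w m + s)
    \<and> (\<forall>n. ?\<phi> w (n * t - circ s t) = w n * t - circ s t)" for w
  have Q_comp: "Q (v \<circ> w)" if "Q v" "Q w" for v w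
    using that comp[of v w] closed[of v w] by (simp add: Q_def)
  have "Q (w_gen s i)" for i
    unfolding Q_def gen using w_gen_in_affine_sym[OF s] level_gen_progression[OF co]
    by (simp add: level_gen_eq_reflection reflection_shift)
  then have Q_gen: "Q (v_gen s i)" for i
    unfolding v_gen_def by (simp add: Q_comp)
  have "Q w" using s w
  proof (induction rule: symmetric_perms_induct)
    case id
    have "?\<phi> id = id" using h.hom_one affine_sym_simps(2)[OF s0] by simp
    moreover have "id \<in> carrier ?G" using h.G.one_closed affine_sym_simps(2)[OF s0] by simp
    ultimately show ?case unfolding Q_def by (simp only: id_apply simp_thms)
  next
    case (step w i)
    then show ?case using Q_comp Q_gen by blast
  qed
  then show "bij (?\<phi> w)" "?\<phi> w (m + s) = ?\<phi> w m + s"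
    "?\<phi> w (n * t - circ s t) = w n * t - circ s t"
    using bij by (auto simp: Q_def)
qed

lemma two_circ:
  assumes "coprime s t"
  shows "2 * circ s t = (s - 1) * (t - 1)"
proof -
  have "odd s \<or> odd t" using assms by (metis coprime_common_divisor odd_one)
  then have "even ((s - 1) * (t - 1))" by auto
  then show ?thesis by (simp add: circ_def)
qed

lemma progression_meets_class:
  fixes s t :: int
  assumes "coprime s t"
  obtains n k where "m = n * t - circ s t + k * s"
proof -
  obtain t' where "[t * t' = 1] (mod s)"
    using cong_solve_coprime_int[of t s] assms by (auto simp: coprime_commute)
  then obtain l where l: "t * t' - 1 = s * l" by (auto simp: cong_iff_dvd_diff dvd_def)
  have "m = ((m + circ s t) * t') * t - circ s t + (- (m + circ s t) * l) * s"
  proof -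
    have "(m + circ s t) * (t * t' - 1) = (m + circ s t) * (s * l)" by (simp only: l)
    then show ?thesis by (simp add: algebra_simps)
  qed
  then show thesis by (rule that)
qed

text \<open>
  The progression \<open>n * t - circ s t\<close> meets every class modulo \<open>s\<close>, so its image together with
  periodicity determines the whole permutation.
\<close>

lemma level_action_eqI:
  assumes "s \<ge> 2" and co: "coprime s t" and "w \<in> symmetric_perms s"
    and shift: "\<And>m. f (m + s) = f m + s"
    and prog: "\<And>n. f (n * t - circ s t) = w n * t - circ s t"
  shows "level_action s t w = f"
proof
  fix m
  obtain n k where m: "m = n * t - circ s t + k * s" by (rule progression_meets_class[OF co])
  show "level_action s t w m = f m"
    unfolding m using shift_mult[of f s] shift_mult[of "level_action s t w" s] shift prog
      level_action_symmetric_perm[OF assms(1-3)] by simp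
qed

lemma level_action_cong_t:
  assumes "s \<ge> 2" and co: "coprime s t" and "w \<in> symmetric_perms s"
  shows "[level_action s t w m = m] (mod t)"
proof -
  obtain n k where m: "m = n * t - circ s t + k * s" by (rule progression_meets_class[OF co])
  have "level_action s t w m - m = t * (w n - n)"
    unfolding m using shift_mult[of "level_action s t w" s "n * t - circ s t" k]
      level_action_symmetric_perm[OF assms] by (simp add: algebra_simps)
  then show ?thesis by (simp add: cong_iff_dvd_diff)
qed

text \<open>
  The offset \<open>circ s t\<close> is chosen so that, up to multiples of \<open>s\<close>, the reflection \<open>m \<mapsto> - 1 - m\<close> acts
  on the progression as it acts on the index \<open>n\<close>.
\<close>

lemma progression_negate:
  assumes "coprime s t"
  shows "- 1 - (n * t - circ s t) = (- 1 - n) * t - circ s t + (t - 1) * s"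
  using two_circ[OF assms] by (simp add: algebra_simps)

lemma level_action_negate:
  assumes "s \<ge> 2" and co: "coprime s t" and w: "w \<in> symmetric_perms s"
  shows "level_action s t w (- 1 - m) = - 1 - level_action s t w m"
proof -
  let ?\<phi> = "level_action s t w"
  note L = level_action_symmetric_perm[OF assms]
  have shift: "?\<phi> (m + k * s) = ?\<phi> m + k * s" for m k by (rule shift_mult) (rule L(2))
  obtain n k where m: "m = n * t - circ s t + k * s" by (rule progression_meets_class[OF co])
  have "- 1 - m = (- 1 - n) * t - circ s t + (t - 1 - k) * s"
    unfolding m using progression_negate[OF co, of n] by (simp add: algebra_simps)
  then have "?\<phi> (- 1 - m) = w (- 1 - n) * t - circ s t + (t - 1 - k) * s"
    by (simp only: shift L(3))
  also have "\<dots> = - 1 - (w n * t - circ s t + k * s)"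
    unfolding symmetric_permsD(3)[OF w, of n]
    using progression_negate[OF co, of "w n"] by (simp add: algebra_simps)
  finally show ?thesis unfolding m shift L(3) .
qed

section \<open>Counting equivariant permutations\<close>

definition equivariant_perms :: "('a \<Rightarrow> 'a) \<Rightarrow> ('a \<Rightarrow> 'b) \<Rightarrow> 'a set \<Rightarrow> ('a \<Rightarrow> 'a) set" where
  "equivariant_perms \<rho> \<kappa> D =
     {\<pi>. \<pi> permutes D \<and> (\<forall>x\<in>D. \<kappa> (\<pi> x) = \<kappa> x \<and> \<pi> (\<rho> x) = \<rho> (\<pi> x))}"

lemma equivariant_perms_comp:
  assumes "\<pi> \<in> equivariant_perms \<rho> \<kappa> D" and "\<sigma> \<in> equivariant_perms \<rho> \<kappa> D"
  shows "\<pi> \<circ> \<sigma> \<in> equivariant_perms \<rho> \<kappa> D"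
  using assms by (auto simp: equivariant_perms_def permutes_compose permutes_in_image)

lemma equivariant_perms_remove_orbit:
  assumes "x \<in> D" and "\<rho> (\<rho> x) = x"
  shows "{\<pi> \<in> equivariant_perms \<rho> \<kappa> D. \<pi> x = x} = equivariant_perms \<rho> \<kappa> (D - {x, \<rho> x})"
proof (intro Set.set_eqI iffI)
  fix \<pi> assume "\<pi> \<in> {\<pi> \<in> equivariant_perms \<rho> \<kappa> D. \<pi> x = x}"
  then have \<pi>: "\<pi> permutes D" "\<pi> x = x" "\<pi> (\<rho> x) = \<rho> x"
    and eq: "\<And>z. z \<in> D \<Longrightarrow> \<kappa> (\<pi> z) = \<kappa> z \<and> \<pi> (\<rho> z) = \<rho> (\<pi> z)"
    using assms(1) by (auto simp: equivariant_perms_def)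
  have "\<pi> permutes (D - {x, \<rho> x})"
    using \<pi>(1) by (rule permutes_superset) (use \<pi> in auto)
  then show "\<pi> \<in> equivariant_perms \<rho> \<kappa> (D - {x, \<rho> x})"
    using eq by (simp add: equivariant_perms_def)
next
  fix \<pi> assume *: "\<pi> \<in> equivariant_perms \<rho> \<kappa> (D - {x, \<rho> x})"
  then have "\<pi> permutes (D - {x, \<rho> x})" by (simp add: equivariant_perms_def)
  then have \<pi>: "\<pi> permutes D" "\<pi> x = x" "\<pi> (\<rho> x) = \<rho> x"
    by (auto intro: permutes_subset permutes_not_in)
  have "\<kappa> (\<pi> z) = \<kappa> z \<and> \<pi> (\<rho> z) = \<rho> (\<pi> z)" if "z \<in> D" for z
  proof (cases "z = x \<or> z = \<rho> x")
    case True
    then show ?thesis using \<pi> assms(2) by auto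
  next
    case False
    then show ?thesis using * that by (simp add: equivariant_perms_def)
  qed
  then show "\<pi> \<in> {\<pi> \<in> equivariant_perms \<rho> \<kappa> D. \<pi> x = x}"
    using \<pi> by (simp add: equivariant_perms_def)
qed

text \<open>
  Orbit counting: an equivariant permutation can send \<open>x\<close> to any point of its colour, and all these
  choices are equally frequent.  Once \<open>x\<close> is fixed, so is \<open>\<rho> x\<close>, and what remains is an equivariant
  permutation of the rest.
\<close>

lemma card_equivariant_perms_step:
  assumes fin: "finite D" and x: "x \<in> D"
    and \<rho>\<rho>: "\<And>z. \<rho> (\<rho> z) = z" and \<rho>D: "\<And>z. z \<in> D \<Longrightarrow> \<rho> z \<in> D" and free: "\<And>z. z \<in> D \<Longrightarrow> \<rho> z \<noteq> z"
    and \<kappa>\<rho>: "\<And>z z'. z \<in> D \<Longrightarrow> z' \<in> D \<Longrightarrow> \<kappa> z = \<kappa> z' \<Longrightarrow> \<kappa> (\<rho> z) = \<kappa> (\<rho> z')"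
  shows "card (equivariant_perms \<rho> \<kappa> D) =
    card {z \<in> D. \<kappa> z = \<kappa> x} * card (equivariant_perms \<rho> \<kappa> (D - {x, \<rho> x}))"
proof -
  let ?A = "equivariant_perms \<rho> \<kappa> D" and ?Z = "{z \<in> D. \<kappa> z = \<kappa> x}"
  have finA: "finite ?A"
    by (rule finite_subset[OF _ finite_permutations[OF fin]]) (auto simp: equivariant_perms_def)
  have fibre: "card {\<pi> \<in> ?A. \<pi> x = z} = card (equivariant_perms \<rho> \<kappa> (D - {x, \<rho> x}))"
    if z: "z \<in> ?Z" for z
  proof -
    \<comment> \<open>the equivariant involution exchanging \<open>x\<close> with \<open>z\<close>; it also covers \<open>z = x\<close> and \<open>z = \<rho> x\<close>\<close>
    define \<tau> where "\<tau> y = (if y = x then z else if y = z then x else if y = \<rho> x then \<rho> z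
      else if y = \<rho> z then \<rho> x else y)" for y
    have inj: "\<rho> a = \<rho> b \<longleftrightarrow> a = b" for a b using \<rho>\<rho> by metis
    have move: "\<rho> y = x \<longleftrightarrow> y = \<rho> x" "\<rho> y = z \<longleftrightarrow> y = \<rho> z" for y using \<rho>\<rho> by metis+
    have zD: "z \<in> D" "\<kappa> z = \<kappa> x" using z by auto
    have ne: "\<rho> x \<noteq> x" "\<rho> z \<noteq> z" using free x zD by auto
    have \<tau>\<tau>: "\<tau> (\<tau> y) = y" and \<tau>\<rho>: "\<tau> (\<rho> y) = \<rho> (\<tau> y)" for y
    proof -
      have "\<tau> (\<tau> y) = y \<and> \<tau> (\<rho> y) = \<rho> (\<tau> y)"
      proof (cases "z = \<rho> x")
        case True
        then have "\<tau> y = (if y = x then \<rho> x else if y = \<rho> x then x else y)" for y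
          by (simp add: \<tau>_def \<rho>\<rho>)
        then show ?thesis using ne by (simp add: \<rho>\<rho> inj move)
      next
        case False
        then have "x \<noteq> \<rho> z" using \<rho>\<rho> by metis
        then show ?thesis using False ne by (simp add: \<tau>_def \<rho>\<rho> inj move)
      qed
      then show "\<tau> (\<tau> y) = y" "\<tau> (\<rho> y) = \<rho> (\<tau> y)" by blast+
    qed
    have \<tau>x: "\<tau> x = z" "\<tau> z = x" by (auto simp: \<tau>_def)
    have "\<tau> y = y" if "y \<notin> D" for y
      using that x zD \<rho>D by (auto simp: \<tau>_def)
    then have "\<tau> permutes D" unfolding permutes_def using \<tau>\<tau> by metis
    moreover have "\<kappa> (\<tau> y) = \<kappa> y" if "y \<in> D" for y
      using zD x \<kappa>\<rho>[of z x] by (auto simp: \<tau>_def)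
    ultimately have \<tau>A: "\<tau> \<in> ?A" using \<tau>\<rho> by (simp add: equivariant_perms_def)
    have "bij_betw (\<lambda>\<pi>. \<tau> \<circ> \<pi>) {\<pi> \<in> ?A. \<pi> x = z} {\<pi> \<in> ?A. \<pi> x = x}"
      by (rule bij_betw_byWitness[of _ "\<lambda>\<pi>. \<tau> \<circ> \<pi>"])
        (use \<tau>x in \<open>auto simp: \<tau>\<tau> fun_eq_iff equivariant_perms_comp[OF \<tau>A]\<close>)
    then have "card {\<pi> \<in> ?A. \<pi> x = z} = card {\<pi> \<in> ?A. \<pi> x = x}"
      by (rule bij_betw_same_card)
    then show ?thesis using equivariant_perms_remove_orbit[of x D \<rho> \<kappa>, OF x \<rho>\<rho>] by simp
  qed
  have "?A = (\<Union>z\<in>?Z. {\<pi> \<in> ?A. \<pi> x = z})"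
    using x by (auto simp: equivariant_perms_def permutes_in_image)
  then have "card ?A = card (\<Union>z\<in>?Z. {\<pi> \<in> ?A. \<pi> x = z})" by simp
  also have "\<dots> = (\<Sum>z\<in>?Z. card {\<pi> \<in> ?A. \<pi> x = z})"
    using fin finA by (intro card_UN_disjoint) auto
  also have "\<dots> = card ?Z * card (equivariant_perms \<rho> \<kappa> (D - {x, \<rho> x}))"
    using fibre by simp
  finally show ?thesis .
qed

text \<open>
  The involution \<open>\<rho>\<close> induces an involution \<open>h\<close> on colours.  Here \<open>I\<close> contains one colour from each
  pair of distinct colours exchanged by \<open>h\<close>, and \<open>J\<close> contains the colours fixed by \<open>h\<close>.  A permutation of
  a class in \<open>I\<close> is arbitrary and dictates the one on the opposite class; a class in \<open>J\<close> of size
  \<open>2 y\<close> contributes the hyperoctahedral group of order \<open>2 ^ y * fact y\<close>.  The proof removes one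
  orbit \<open>{x, \<rho> x}\<close> at a time.
\<close>

lemma card_equivariant_perms:
  fixes \<kappa> :: "'a \<Rightarrow> 'b"
  assumes "finite D" and \<rho>\<rho>: "\<And>z. \<rho> (\<rho> z) = z"
    and "\<And>z. z \<in> D \<Longrightarrow> \<rho> z \<in> D" and "\<And>z. z \<in> D \<Longrightarrow> \<rho> z \<noteq> z"
    and \<kappa>\<rho>: "\<And>z. z \<in> D \<Longrightarrow> \<kappa> (\<rho> z) = h (\<kappa> z)"
    and I: "finite I" "\<And>i. i \<in> I \<Longrightarrow> h i \<notin> I \<union> J" and J: "finite J" "\<And>j. j \<in> J \<Longrightarrow> h j = j" "I \<inter> J = {}"
    and cover: "\<And>z. z \<in> D \<Longrightarrow> \<kappa> z \<in> I \<union> J \<or> h (\<kappa> z) \<in> I"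
  shows "(\<forall>j\<in>J. even (card {z \<in> D. \<kappa> z = j})) \<and>
    card (equivariant_perms \<rho> \<kappa> D) =
    (\<Prod>j\<in>J. 2 ^ (card {z \<in> D. \<kappa> z = j} div 2) * fact (card {z \<in> D. \<kappa> z = j} div 2)) *
    (\<Prod>i\<in>I. fact (card {z \<in> D. \<kappa> z = i}))"
  using assms(1,3-5) cover
proof (induction "card D" arbitrary: D rule: less_induct)
  case less
  show ?case
  proof (cases "D = {}")
    case True
    have "equivariant_perms \<rho> \<kappa> D = {id}" unfolding True by (auto simp: equivariant_perms_def)
    then show ?thesis using True by simp
  next
    case False
    then obtain x' where x': "x' \<in> D" by blast
    \<comment> \<open>each orbit has a point whose colour indexes a factor of the product\<close>
    define x where "x = (if \<kappa> x' \<in> I \<union> J then x' else \<rho> x')"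
    have x: "x \<in> D" "\<kappa> x \<in> I \<union> J"
      using x' less.prems(2)[OF x'] less.prems(4)[OF x'] less.prems(5)[OF x'] by (auto simp: x_def)
    define E where "E = D - {x, \<rho> x}"
    have \<rho>x: "\<rho> x \<in> D" "\<rho> x \<noteq> x" using less.prems x by auto
    have inj: "\<rho> a = b \<longleftrightarrow> a = \<rho> b" for a b using \<rho>\<rho> by metis
    have "card E < card D" using less.prems(1) x by (intro psubset_card_mono) (auto simp: E_def)
    moreover have "\<rho> z \<in> E" if "z \<in> E" for z using that less.prems(2) by (auto simp: E_def inj \<rho>\<rho>)
    ultimately have IH: "(\<forall>j\<in>J. even (card {z \<in> E. \<kappa> z = j})) \<and>
      card (equivariant_perms \<rho> \<kappa> E) =
      (\<Prod>j\<in>J. 2 ^ (card {z \<in> E. \<kappa> z = j} div 2) * fact (card {z \<in> E. \<kappa> z = j} div 2)) *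
      (\<Prod>i\<in>I. fact (card {z \<in> E. \<kappa> z = i}))"
      using less.prems by (intro less.hyps) (auto simp: E_def)
    have step: "card (equivariant_perms \<rho> \<kappa> D) = card {z \<in> D. \<kappa> z = \<kappa> x} * card (equivariant_perms \<rho> \<kappa> E)"
      unfolding E_def using less.prems x \<rho>\<rho> by (intro card_equivariant_perms_step) auto
    have other: "{z \<in> D. \<kappa> z = k} = {z \<in> E. \<kappa> z = k}" if "k \<noteq> \<kappa> x" "k \<noteq> h (\<kappa> x)" for k
      using that less.prems(4)[OF x(1)] by (auto simp: E_def)
    let ?F = "\<lambda>D j. 2 ^ (card {z \<in> D. \<kappa> z = j} div 2) * fact (card {z \<in> D. \<kappa> z = j} div 2) :: nat"
    let ?G = "\<lambda>D i. fact (card {z \<in> D. \<kappa> z = i}) :: nat"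
    have finE: "finite {z \<in> E. \<kappa> z = k}" for k using less.prems(1) by (simp add: E_def)
    show ?thesis
    proof (cases "\<kappa> x \<in> I")
      case True
      have hx: "h (\<kappa> x) \<notin> I" "h (\<kappa> x) \<notin> J" "\<kappa> x \<notin> J" using I(2)[OF True] True J(3) by auto
      have "{z \<in> D. \<kappa> z = \<kappa> x} = insert x {z \<in> E. \<kappa> z = \<kappa> x}"
        using x less.prems(4)[OF x(1)] hx True by (auto simp: E_def)
      then have "card {z \<in> D. \<kappa> z = \<kappa> x} = Suc (card {z \<in> E. \<kappa> z = \<kappa> x})"
        using finE[of "\<kappa> x"] by (simp add: E_def)
      then have Gx: "?G D (\<kappa> x) = card {z \<in> D. \<kappa> z = \<kappa> x} * ?G E (\<kappa> x)" by simp
      have "(\<Prod>i\<in>I. ?G D i) = ?G D (\<kappa> x) * (\<Prod>i\<in>I - {\<kappa> x}. ?G D i)"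
        by (rule prod.remove[OF I(1) True])
      also have "(\<Prod>i\<in>I - {\<kappa> x}. ?G D i) = (\<Prod>i\<in>I - {\<kappa> x}. ?G E i)"
      proof (rule prod.cong[OF refl])
        fix i assume i: "i \<in> I - {\<kappa> x}"
        then have "i \<noteq> h (\<kappa> x)" using hx(1) by auto
        then show "?G D i = ?G E i" using other[of i] i by simp
      qed
      also have "?G D (\<kappa> x) * (\<Prod>i\<in>I - {\<kappa> x}. ?G E i) =
          card {z \<in> D. \<kappa> z = \<kappa> x} * (?G E (\<kappa> x) * (\<Prod>i\<in>I - {\<kappa> x}. ?G E i))"
        unfolding Gx by (rule mult.assoc)
      also have "?G E (\<kappa> x) * (\<Prod>i\<in>I - {\<kappa> x}. ?G E i) = (\<Prod>i\<in>I. ?G E i)"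
        by (rule prod.remove[OF I(1) True, symmetric])
      finally have G: "(\<Prod>i\<in>I. ?G D i) = card {z \<in> D. \<kappa> z = \<kappa> x} * (\<Prod>i\<in>I. ?G E i)" .
      have eqJ: "{z \<in> D. \<kappa> z = j} = {z \<in> E. \<kappa> z = j}" if "j \<in> J" for j
      proof (rule other)
        show "j \<noteq> \<kappa> x" "j \<noteq> h (\<kappa> x)" using hx that by auto
      qed
      then have "(\<Prod>j\<in>J. ?F D j) = (\<Prod>j\<in>J. ?F E j)" by (intro prod.cong) auto
      then show ?thesis unfolding step G using IH eqJ by (simp add: algebra_simps)
    next
      case False
      then have xJ: "\<kappa> x \<in> J" "h (\<kappa> x) = \<kappa> x" using x J(2) by auto
      have "{z \<in> D. \<kappa> z = \<kappa> x} = insert x (insert (\<rho> x) {z \<in> E. \<kappa> z = \<kappa> x})"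
        using x \<rho>x less.prems(4)[OF x(1)] xJ by (auto simp: E_def)
      then have c: "card {z \<in> D. \<kappa> z = \<kappa> x} = Suc (Suc (card {z \<in> E. \<kappa> z = \<kappa> x}))"
        using finE[of "\<kappa> x"] \<rho>x(2) by (simp add: E_def)
      have ev: "even (card {z \<in> E. \<kappa> z = \<kappa> x})" using IH xJ by blast
      then obtain y where y: "card {z \<in> E. \<kappa> z = \<kappa> x} = 2 * y" by blast
      have Fx: "?F D (\<kappa> x) = card {z \<in> D. \<kappa> z = \<kappa> x} * ?F E (\<kappa> x)"
        unfolding c y by (simp add: algebra_simps)
      have "(\<Prod>i\<in>J. ?F D i) = ?F D (\<kappa> x) * (\<Prod>i\<in>J - {\<kappa> x}. ?F D i)"
        by (rule prod.remove[OF J(1) xJ(1)])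
      also have "(\<Prod>i\<in>J - {\<kappa> x}. ?F D i) = (\<Prod>i\<in>J - {\<kappa> x}. ?F E i)"
        by (rule prod.cong[OF refl]) (simp add: other xJ)
      also have "?F D (\<kappa> x) * (\<Prod>i\<in>J - {\<kappa> x}. ?F E i) =
          card {z \<in> D. \<kappa> z = \<kappa> x} * (?F E (\<kappa> x) * (\<Prod>i\<in>J - {\<kappa> x}. ?F E i))"
        unfolding Fx by (rule mult.assoc)
      also have "?F E (\<kappa> x) * (\<Prod>i\<in>J - {\<kappa> x}. ?F E i) = (\<Prod>i\<in>J. ?F E i)"
        by (rule prod.remove[OF J(1) xJ(1), symmetric])
      finally have F: "(\<Prod>j\<in>J. ?F D j) = card {z \<in> D. \<kappa> z = \<kappa> x} * (\<Prod>j\<in>J. ?F E j)" .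
      have "(\<Prod>i\<in>I. ?G D i) = (\<Prod>i\<in>I. ?G E i)"
      proof (rule prod.cong[OF refl])
        fix i assume "i \<in> I"
        then have "i \<noteq> \<kappa> x" using False by auto
        then show "?G D i = ?G E i" using other[of i] xJ by simp
      qed
      moreover have "even (card {z \<in> D. \<kappa> z = j})" if "j \<in> J" for j
        using IH that other[of j] xJ c by (cases "j = \<kappa> x") auto
      ultimately show ?thesis unfolding step F using IH by (simp add: algebra_simps)
    qed
  qed
qed

section \<open>Flush bead configurations and their first vacant positions\<close>

text \<open>
  For a flush configuration of beads these are the first vacant positions of the runners.
\<close>

definition first_gaps :: "int \<Rightarrow> int set \<Rightarrow> int set" where
  "first_gaps s B = {m. m \<notin> B \<and> m - s \<in> B}"

text \<open>
  Beads on the abacus with \<open>s\<close> runners, all pushed towards \<open>- \<infinity>\<close>, as given for example by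
  the beta-sets of \<open>s\<close>-cores.
\<close>

locale flush_bead_set =
  fixes s :: int and B :: "int set"
  assumes s: "s \<ge> 2"
    and closed: "m \<in> B \<Longrightarrow> m - s \<in> B"
    and bounded: "\<exists>N. \<forall>m. (m \<in> B \<longrightarrow> m < N) \<and> (m < - N \<longrightarrow> m \<in> B)"
begin

abbreviation "S \<equiv> first_gaps s B"

lemma closed_multiple: "m \<in> B \<Longrightarrow> m - int k * s \<in> B"
proof (induction k)
  case (Suc k)
  then show ?case using closed[of "m - int k * s"] by (simp add: algebra_simps)
qed simp

lemma below_iff:
  assumes x: "x \<in> S"
  shows "x + k * s \<in> B \<longleftrightarrow> k < 0"
proof
  assume *: "x + k * s \<in> B"
  show "k < 0"
  proof (rule ccontr)
    assume "\<not> k < 0"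
    then have "x \<in> B" using closed_multiple[OF *, of "nat k"] by simp
    then show False using x by (simp add: first_gaps_def)
  qed
next
  assume "k < 0"
  moreover have "x - s \<in> B" using x by (simp add: first_gaps_def)
  ultimately show "x + k * s \<in> B"
    using closed_multiple[of "x - s" "nat (- k - 1)"] by (simp add: algebra_simps)
qed

text \<open>
  Each runner is full far down and empty far up, so it has a least vacant position.
\<close>

lemma unique_representative: "\<exists>!x. x \<in> S \<and> [x = m] (mod s)"
proof -
  obtain N where N: "\<And>m. m \<in> B \<Longrightarrow> m < N" "\<And>m. m < - N \<Longrightarrow> m \<in> B" using bounded by blast
  have large: "\<bar>a\<bar> \<le> \<bar>a\<bar> * s" for a
    using s mult_left_mono[of 1 s "\<bar>a\<bar>"] by simp
  have "\<exists>k::nat. m + (int k - (\<bar>N\<bar> + \<bar>m\<bar> + 1)) * s \<notin> B"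
  proof
    have "m + (\<bar>N\<bar> + \<bar>m\<bar>) * s \<ge> N" using large[of "\<bar>N\<bar> + \<bar>m\<bar>"] by simp
    then show "m + (int (nat (2 * (\<bar>N\<bar> + \<bar>m\<bar>) + 1)) - (\<bar>N\<bar> + \<bar>m\<bar> + 1)) * s \<notin> B"
      using N(1)[of "m + (\<bar>N\<bar> + \<bar>m\<bar>) * s"] by force
  qed
  then obtain k :: nat where k: "m + (int k - (\<bar>N\<bar> + \<bar>m\<bar> + 1)) * s \<notin> B"
    and least: "\<And>j. j < k \<Longrightarrow> m + (int j - (\<bar>N\<bar> + \<bar>m\<bar> + 1)) * s \<in> B"
    using exists_least_iff[of "\<lambda>k. m + (int k - (\<bar>N\<bar> + \<bar>m\<bar> + 1)) * s \<notin> B"] by blast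
  define x where "x = m + (int k - (\<bar>N\<bar> + \<bar>m\<bar> + 1)) * s"
  have "m - (\<bar>N\<bar> + \<bar>m\<bar> + 1) * s \<in> B" 
    using large[of "\<bar>N\<bar> + \<bar>m\<bar> + 1"] by (intro N(2)) linarith
  then have "k \<noteq> 0" using k by (intro notI) (simp add: algebra_simps)
  then have "m + (int (k - 1) - (\<bar>N\<bar> + \<bar>m\<bar> + 1)) * s \<in> B" by (intro least) simp
  moreover have "m + (int (k - 1) - (\<bar>N\<bar> + \<bar>m\<bar> + 1)) * s = x - s"
    using \<open>k \<noteq> 0\<close> by (simp add: x_def algebra_simps of_nat_diff)
  ultimately have "x - s \<in> B" by (simp only:)
  then have "x \<in> S" using k unfolding first_gaps_def x_def by blast
  moreover have "[x = m] (mod s)" by (simp add: x_def cong_iff_dvd_diff)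
  moreover have "y = x" if "x \<in> S" "y \<in> S" "[x = m] (mod s)" "[y = m] (mod s)" for x y
  proof -
    have "[y = x] (mod s)" using that(3,4) by (auto simp: cong_def)
    then obtain k where k: "y = x + k * s" by (auto simp: cong_iff_dvd_diff dvd_def algebra_simps eq_diff_eq)
    then have "x + k * s \<notin> B" "x + (k - 1) * s \<in> B"
      using that(2) by (simp_all add: first_gaps_def algebra_simps)
    then show ?thesis using below_iff[OF that(1)] k by simp
  qed
  ultimately show ?thesis by blast
qed

definition rep :: "int \<Rightarrow> int" where
  "rep m = (THE x. x \<in> S \<and> [x = m] (mod s))"

lemma rep: "rep m \<in> S" "[rep m = m] (mod s)"
  using theI'[OF unique_representative, of m] by (simp_all add: rep_def)

lemma rep_eqI: "x \<in> S \<Longrightarrow> [x = m] (mod s) \<Longrightarrow> rep m = x"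
  using unique_representative[of m] rep[of m] by blast

lemma rep_in: "x \<in> S \<Longrightarrow> rep x = x"
  by (rule rep_eqI) auto

lemma rep_shift:
  obtains k where "m = rep m + k * s"
  using rep(2)[of m] by (metis cong_iff_lin mult.commute)

lemma finite_S: "finite S"
proof -
  have "inj_on (\<lambda>x. x mod s) S"
  proof (rule inj_onI)
    fix x y assume "x \<in> S" "y \<in> S" "x mod s = y mod s"
    then show "x = y" using rep_in[of x] rep_eqI[of y x] by (simp add: cong_def)
  qed
  moreover have "finite ((\<lambda>x. x mod s) ` S)"
    by (rule finite_subset[of _ "{0..<s}"]) (use s in auto)
  ultimately show ?thesis by (rule finite_imageD[rotated])
qed

text \<open>
  Beads and first vacant positions determine each other, compatibly with periodic permutations.
\<close>

lemma image_eq_iff: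
  assumes bij: "bij f" and shift: "\<And>m. f (m + s) = f m + s"
  shows "f ` B = B \<longleftrightarrow> f ` S = S"
proof
  have sh: "f (m - s) = f m - s" for m using shift[of "m - s"] by simp
  have sh': "f (m + k * s) = f m + k * s" for m k using shift by (rule shift_mult)
  have mem: "f m \<in> f ` A \<longleftrightarrow> m \<in> A" for m A using bij by (simp add: bij_is_inj inj_image_mem_iff)
  have surj: "\<exists>n. m = f n" for m using bij by (metis bij_pointE)
  {
    assume fB: "f ` B = B"
    have eq: "f m \<in> S \<longleftrightarrow> m \<in> S" for m
      using mem[of m B] mem[of "m - s" B] unfolding fB by (simp add: first_gaps_def sh)
    show "f ` S = S"
      using eq surj by (metis (no_types, lifting) Set.set_eqI image_iff mem)
  }
  {
    assume fS: "f ` S = S"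
    have eq: "f m \<in> B \<longleftrightarrow> m \<in> B" for m
    proof -
      obtain k where k: "m = rep m + k * s" by (rule rep_shift)
      have "f (rep m) \<in> S" using fS rep(1) by blast
      moreover have "f m = f (rep m) + k * s" using sh'[of "rep m" k] k by simp
      ultimately show ?thesis using below_iff rep(1) k by metis
    qed
    show "f ` B = B"
      using eq surj by (metis (no_types, lifting) Set.set_eqI image_iff mem)
  }
qed

text \<open>
  The unique periodic extension of a permutation of the first vacant positions.
\<close>

definition extend :: "(int \<Rightarrow> int) \<Rightarrow> int \<Rightarrow> int" where
  "extend \<pi> m = \<pi> (rep m) + (m - rep m)"

lemma extend_S: "x \<in> S \<Longrightarrow> extend \<pi> x = \<pi> x"
  by (simp add: extend_def rep_in)

lemma extend_shift: "extend \<pi> (m + s) = extend \<pi> m + s"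
proof -
  have "rep (m + s) = rep m"
    using rep[of m] by (intro rep_eqI) (simp_all add: cong_def)
  then show ?thesis by (simp add: extend_def)
qed

lemma extend_comp:
  assumes "\<pi> permutes S" and "\<sigma> permutes S"
  shows "extend \<pi> (extend \<sigma> m) = extend (\<pi> \<circ> \<sigma>) m"
proof -
  have "extend \<sigma> m - \<sigma> (rep m) = m - rep m" by (simp add: extend_def)
  then have "[\<sigma> (rep m) = extend \<sigma> m] (mod s)"
    using rep(2)[of m] by (metis cong_iff_dvd_diff cong_sym)
  moreover have "\<sigma> (rep m) \<in> S" using assms(2) rep(1) by (simp add: permutes_in_image)
  ultimately have "rep (extend \<sigma> m) = \<sigma> (rep m)" by (intro rep_eqI)
  then show ?thesis by (simp add: extend_def[of \<pi>] extend_def[of "\<pi> \<circ> \<sigma>"]) (simp add: extend_def)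
qed

lemma extend_bij:
  assumes "\<pi> permutes S"
  shows "bij (extend \<pi>)"
proof -
  have "extend id = id" by (simp add: extend_def fun_eq_iff)
  moreover have "extend (inv_into UNIV \<pi>) \<circ> extend \<pi> = extend id"
    using extend_comp[OF permutes_inv[OF assms] assms] permutes_inv_o[OF assms] by (simp add: fun_eq_iff)
  moreover have "extend \<pi> \<circ> extend (inv_into UNIV \<pi>) = extend id"
    using extend_comp[OF assms permutes_inv[OF assms]] permutes_inv_o[OF assms] by (simp add: fun_eq_iff)
  ultimately show ?thesis using o_bij by metis
qed

end

section \<open>The stabiliser as a group of equivariant permutations\<close>

lemma s_set_eq_first_gaps:
  assumes "flush_bead_set s (beta_set p)"
  shows "s_set s p = first_gaps s (beta_set p)"
proof -
  interpret flush_bead_set s "beta_set p" by (rule assms)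
  have least: "(LEAST a. [a = i] (mod s) \<and> a \<notin> beta_set p) = rep i" for i
  proof (rule Least_equality)
    show "[rep i = i] (mod s) \<and> rep i \<notin> beta_set p"
      using rep[of i] by (simp add: first_gaps_def)
    fix y assume y: "[y = i] (mod s) \<and> y \<notin> beta_set p"
    then have "[y = rep i] (mod s)" using rep(2)[of i] by (auto simp: cong_def)
    then obtain k where k: "y = rep i + k * s" by (metis cong_iff_lin cong_sym mult.commute)
    then have "0 \<le> k" using below_iff[OF rep(1)[of i], of k] y by simp
    then show "rep i \<le> y" using k s by simp
  qed
  have "s_set s p = range rep" by (auto simp: s_set_def least)
  moreover have "x \<in> range rep" if "x \<in> S" for x
    using rep_in[OF that] by (metis rangeI)
  then have "range rep = S" using rep(1) by blast
  ultimately show ?thesis by simp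
qed

lemma self_conj_core_bead_set:
  assumes p: "p \<in> self_conj_cores s" and s: "s \<ge> 2"
  shows "flush_bead_set s (beta_set p)"
    and "- 1 - m \<in> beta_set p \<longleftrightarrow> m \<notin> beta_set p"
    and "is_partition p"
proof -
  have part: "is_partition p" and core: "p \<in> cores s" and sc: "conjugate p = p"
    using p by (auto simp: self_conj_cores_def cores_def)
  show "is_partition p" by (rule part)
  obtain N where "\<And>m. m \<in> beta_set p \<Longrightarrow> m < N" "\<And>m. m < - N \<Longrightarrow> m \<in> beta_set p"
    using beta_set_bounds[OF part] by blast
  then have "\<exists>N. \<forall>m. (m \<in> beta_set p \<longrightarrow> m < N) \<and> (m < - N \<longrightarrow> m \<in> beta_set p)" by blast
  then show "flush_bead_set s (beta_set p)"
    using s beta_set_core_diff[OF core] by unfold_locales auto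
  show "- 1 - m \<in> beta_set p \<longleftrightarrow> m \<notin> beta_set p" by (rule beta_set_self_conjugate[OF part sc])
qed

lemma first_gaps_reflect:
  fixes s :: int
  assumes "\<And>m. - 1 - m \<in> B \<longleftrightarrow> m \<notin> B"
  shows "s - 1 - m \<in> first_gaps s B \<longleftrightarrow> m \<in> first_gaps s B"
proof -
  have e: "- 1 - (m - s) = s - 1 - m" "s - 1 - m - s = - 1 - m" by simp_all
  have "s - 1 - m \<in> B \<longleftrightarrow> m - s \<notin> B" using assms[of "m - s"] unfolding e(1) .
  then show ?thesis using assms[of m] unfolding first_gaps_def mem_Collect_eq e(2) by blast
qed

text \<open>
  The image of the beta-set is again symmetric and bounded above, hence the beta-set of a partition,
  and partitions are determined by their beta-sets.  Thus stabilising \<open>p\<close> means stabilising its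
  beta-set, or equivalently its \<open>s\<close>-set.
\<close>

lemma StabSC_iff:
  assumes s: "s \<ge> 2" and co: "coprime s t" and p: "p \<in> self_conj_cores s"
  shows "w \<in> StabSC s t p \<longleftrightarrow> w \<in> symmetric_perms s
    \<and> level_action s t w ` first_gaps s (beta_set p) = first_gaps s (beta_set p)"
proof (cases "w \<in> symmetric_perms s")
  case False
  then show ?thesis by (simp add: StabSC_def stabilizer_def carrier_affine_hyp[OF s])
next
  case w: True
  interpret flush_bead_set s "beta_set p" by (rule self_conj_core_bead_set(1)[OF p s])
  let ?f = "level_action s t w" and ?B = "beta_set p"
  note f = level_action_symmetric_perm[OF s co w]
  have part: "is_partition p" by (rule self_conj_core_bead_set(3)[OF p s])
  have core: "p \<in> cores s" using p by (simp add: self_conj_cores_def)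
  have mem: "?f m \<in> ?f ` ?B \<longleftrightarrow> m \<in> ?B" for m
    using f(1) by (simp add: bij_is_inj inj_image_mem_iff)
  have surj: "\<exists>n. m = ?f n" for m using f(1) by (metis bij_pointE)
  have sym: "- 1 - m \<in> ?f ` ?B \<longleftrightarrow> m \<notin> ?f ` ?B" for m
  proof -
    obtain n where n: "m = ?f n" using surj by blast
    have "- 1 - m = ?f (- 1 - n)" unfolding n level_action_negate[OF s co w] by simp
    then show ?thesis using mem[of n] mem[of "- 1 - n"] self_conj_core_bead_set(2)[OF p s, of n] n by simp
  qed
  have "\<exists>N. \<forall>m\<in>?f ` ?B. m < N"
  proof -
    obtain N where N: "\<And>m. m \<in> ?B \<Longrightarrow> m < N" using bounded by blast
    define M where "M = Max ((\<lambda>m. \<bar>?f m - m\<bar>) ` {0..s - 1})"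
    have "?f m < N + M + 1" if "m \<in> ?B" for m
    proof -
      have "?f m - m = ?f (m mod s) - m mod s"
        using displacement_cong[of ?f s m "m mod s"] f(2) by simp
      moreover have "\<bar>?f (m mod s) - m mod s\<bar> \<le> M"
        unfolding M_def using s by (intro Max_ge) auto
      ultimately show ?thesis using N[OF that] by linarith
    qed
    then show ?thesis by blast
  qed
  then obtain N where N: "\<And>m. m \<in> ?f ` ?B \<Longrightarrow> m < N" by blast
  obtain q where q: "is_partition q" "beta_set q = ?f ` ?B"
    using symmetric_set_is_beta_set[OF N sym] by blast
  have the: "(THE q. is_partition q \<and> beta_set q = ?f ` ?B) = q"
    using q beta_set_inj by (intro the_equality) auto
  have "w \<in> StabSC s t p \<longleftrightarrow> q = p"
    using w p core the by (simp add: StabSC_def stabilizer_def carrier_affine_hyp[OF s]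
        level_action_self_conj_def level_action_cores_def)
  also have "\<dots> \<longleftrightarrow> ?f ` ?B = ?B" using q part beta_set_inj by metis
  also have "\<dots> \<longleftrightarrow> ?f ` S = S" by (rule image_eq_iff[OF f(1) f(2)])
  finally show ?thesis using w by simp
qed

text \<open>
  Restriction to the \<open>s\<close>-set is a bijection.  It is injective because the \<open>s\<close>-set represents all
  classes modulo \<open>s\<close>.  For surjectivity, extend a permutation \<open>\<pi>\<close> of the \<open>s\<close>-set periodically to \<open>g\<close>;
  as \<open>g m\<close> is congruent to \<open>m\<close> modulo \<open>t\<close>, it maps the progression \<open>n * t - circ s t\<close> onto itself, and
  reading off the indices yields the preimage \<open>w\<close>.  On the \<open>s\<close>-set the reflection becomes
  \<open>m \<mapsto> s - 1 - m\<close>, since \<open>s\<close>-sets consist of gaps rather than beads.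
\<close>

lemma card_StabSC:
  fixes \<kappa> :: "int \<Rightarrow> int"
  assumes s: "s \<ge> 2" and t: "t \<ge> 1" and co: "coprime s t" and p: "p \<in> self_conj_cores s"
    and \<kappa>: "\<And>x y. \<kappa> x = \<kappa> y \<longleftrightarrow> [x = y] (mod t)"
  shows "card (StabSC s t p) =
    card (equivariant_perms (\<lambda>m. s - 1 - m) \<kappa> (s_set s p))"
proof -
  interpret flush_bead_set s "beta_set p" by (rule self_conj_core_bead_set(1)[OF p s])
  have S: "s_set s p = S" by (rule s_set_eq_first_gaps) (rule flush_bead_set_axioms)
  have reflS: "s - 1 - m \<in> S \<longleftrightarrow> m \<in> S" for m
    by (rule first_gaps_reflect) (rule self_conj_core_bead_set(2)[OF p s])
  let ?\<rho> = "\<lambda>m. s - 1 - m" and ?f = "level_action s t"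
  let ?A = "equivariant_perms ?\<rho> \<kappa> S"
  define res where "res w = (\<lambda>x. if x \<in> S then ?f w x else x)" for w
  have "bij_betw res (StabSC s t p) ?A"
  proof (rule bij_betw_imageI)
    show "inj_on res (StabSC s t p)"
    proof (rule inj_onI)
      fix v w assume vw: "v \<in> StabSC s t p" "w \<in> StabSC s t p" "res v = res w"
      then have sp: "v \<in> symmetric_perms s" "w \<in> symmetric_perms s"
        using StabSC_iff[OF s co p] by auto
      note fv = level_action_symmetric_perm[OF s co sp(1)] and fw = level_action_symmetric_perm[OF s co sp(2)]
      have eqS: "?f v x = ?f w x" if "x \<in> S" for x
        using fun_cong[OF vw(3), of x] that by (simp add: res_def)
      have "?f v m = ?f w m" for m
      proof -
        obtain k where k: "m = rep m + k * s" by (rule rep_shift)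
        have "?f v (rep m + k * s) = ?f w (rep m + k * s)"
          using shift_mult[of "?f v" s "rep m" k] shift_mult[of "?f w" s "rep m" k] fv(2) fw(2)
            eqS[OF rep(1)] by simp
        then show ?thesis using k by simp
      qed
      then have "v n * t - circ s t = w n * t - circ s t" for n using fv(3) fw(3) by metis
      then show "v = w" using t by (auto simp: fun_eq_iff)
    qed
    show "res ` StabSC s t p = ?A"
    proof (intro Set.set_eqI iffI)
      fix \<pi> assume "\<pi> \<in> res ` StabSC s t p"
      then obtain w where w: "w \<in> symmetric_perms s" "?f w ` S = S" "\<pi> = res w"
        using StabSC_iff[OF s co p] by auto
      note f = level_action_symmetric_perm[OF s co w(1)]
      have "bij_betw (?f w) S S"
        using w(2) inj_on_subset[OF bij_is_inj[OF f(1)] subset_UNIV] by (simp add: bij_betw_def)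
      then have "bij_betw (res w) S S"
        by (subst bij_betw_cong[of S _ "?f w"]) (simp_all add: res_def)
      then have "res w permutes S" by (rule bij_imp_permutes) (simp add: res_def)
      moreover have "\<kappa> (res w x) = \<kappa> x" if "x \<in> S" for x
        using that level_action_cong_t[OF s co w(1)] by (simp add: res_def \<kappa>)
      moreover have "res w (?\<rho> x) = ?\<rho> (res w x)" if "x \<in> S" for x
      proof -
        have "?f w (- 1 - x + s) = - 1 - ?f w x + s"
          by (simp only: f(2) level_action_negate[OF s co w(1)])
        moreover have "- 1 - x + s = s - 1 - x" by simp
        ultimately show ?thesis using that reflS[of x] by (simp add: res_def)
      qed
      ultimately show "\<pi> \<in> ?A" by (simp add: equivariant_perms_def w(3))
    next
      fix \<pi> assume \<pi>: "\<pi> \<in> ?A"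
      then have perm: "\<pi> permutes S" by (simp add: equivariant_perms_def)
      let ?g = "extend \<pi>"
      have g_cong: "[?g m = m] (mod t)" for m
      proof -
        have "[\<pi> (rep m) = rep m] (mod t)"
          using \<pi> rep(1) by (simp add: equivariant_perms_def \<kappa>)
        then show ?thesis by (simp add: extend_def cong_iff_dvd_diff algebra_simps)
      qed
      have g_shift: "?g (m + s) = ?g m + s" for m by (rule extend_shift)
      have g_refl: "?g (- 1 - m) = - 1 - ?g m" for m
      proof -
        have "rep (- 1 - m) = s - 1 - rep m"
        proof (rule rep_eqI)
          show "s - 1 - rep m \<in> S" using reflS rep(1) by blast
          have "s dvd (rep m - m)" using rep(2)[of m] by (simp add: cong_iff_dvd_diff)
          moreover have "(s - 1 - rep m) - (- 1 - m) = s - (rep m - m)" by simp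
          ultimately show "[s - 1 - rep m = - 1 - m] (mod s)"
            unfolding cong_iff_dvd_diff by (simp only: dvd_diff dvd_refl)
        qed
        moreover have "\<pi> (s - 1 - rep m) = s - 1 - \<pi> (rep m)"
          using \<pi> rep(1) by (simp add: equivariant_perms_def)
        ultimately show ?thesis by (simp add: extend_def)
      qed
      define w where "w n = (?g (n * t - circ s t) + circ s t) div t" for n
      have gw: "?g (n * t - circ s t) = w n * t - circ s t" for n
      proof -
        have "t dvd ?g (n * t - circ s t) - (n * t - circ s t)"
          using g_cong[of "n * t - circ s t"] by (simp only: cong_iff_dvd_diff)
        then obtain l where "?g (n * t - circ s t) - (n * t - circ s t) = t * l" by blast
        then have "?g (n * t - circ s t) + circ s t = (l + n) * t" by (simp add: algebra_simps)
        then show ?thesis using t by (simp add: w_def)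
      qed
      have bij_g: "bij ?g" by (rule extend_bij[OF perm])
      have "inj w"
      proof (rule injI)
        fix a b assume "w a = w b"
        then have "?g (a * t - circ s t) = ?g (b * t - circ s t)" by (simp add: gw)
        then show "a = b" using bij_g t by (simp add: bij_is_inj inj_eq)
      qed
      moreover have "\<exists>n. k = w n" for k
      proof -
        obtain m where m: "k * t - circ s t = ?g m" using bij_g by (metis bij_pointE)
        have "t dvd ?g m - m" using g_cong[of m] by (simp only: cong_iff_dvd_diff)
        then obtain l where "?g m - m = t * l" by blast
        then have "m + circ s t = (k - l) * t" using m by (simp add: algebra_simps)
        then obtain n where "m + circ s t = n * t" by blast
        then have "m = n * t - circ s t" by simp
        then have "k = w n" using m gw[of n] t by simp
        then show ?thesis by blast
      qed
      ultimately have "bij w" by (auto simp: bij_def)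
      moreover have "w (n + s) = w n + s" for n
      proof -
        have "w (n + s) * t - circ s t = ?g (n * t - circ s t + t * s)"
          unfolding gw[symmetric] by (simp add: algebra_simps)
        also have "\<dots> = (w n + s) * t - circ s t"
          using shift_mult[of ?g s "n * t - circ s t" t] g_shift by (simp add: gw algebra_simps)
        finally show ?thesis using t by simp
      qed
      moreover have "w (- 1 - n) = - 1 - w n" for n
      proof -
        have "- 1 - ?g (n * t - circ s t) = ?g ((- 1 - n) * t - circ s t + (t - 1) * s)"
          by (simp only: g_refl[symmetric] progression_negate[OF co])
        also have "\<dots> = w (- 1 - n) * t - circ s t + (t - 1) * s"
          using shift_mult[of ?g s] g_shift by (simp add: gw)
        finally have "(- 1 - w n) * t - circ s t = w (- 1 - n) * t - circ s t"
          unfolding gw using progression_negate[OF co, of "w n"] by simp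
        then show ?thesis using t by simp
      qed
      ultimately have w: "w \<in> symmetric_perms s" by (simp add: symmetric_perms_def)
      have fw: "?f w = ?g" by (rule level_action_eqI[OF s co w g_shift gw])
      have gS: "?g x = \<pi> x" if "x \<in> S" for x using that by (rule extend_S)
      then have "?f w ` S = S" unfolding fw using permutes_image[OF perm] by (simp cong: image_cong)
      then have "w \<in> StabSC s t p" using StabSC_iff[OF s co p] w by simp
      moreover have "res w = \<pi>"
        using gS permutes_not_in[OF perm] by (auto simp: res_def fw fun_eq_iff)
      ultimately show "\<pi> \<in> res ` StabSC s t p" by blast
    qed
  qed
  then show ?thesis using bij_betw_same_card S by metis
qed

section \<open>The order of the stabiliser\<close>

text \<open>
  Placing the interval from \<open>b\<close> to \<open>b + t - 1\<close> symmetrically about the centre of \<open>m \<mapsto> s - 1 - m\<close>, or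
  with at most one extra point at its upper end, makes the pairing of classes modulo \<open>t\<close> a reflection
  of these integer representatives in which the extra point is paired with itself.
\<close>

definition window :: "int \<Rightarrow> int \<Rightarrow> int \<Rightarrow> int" where
  "window t b x = b + (x - b) mod t"

lemma window_bounds:
  assumes "t \<ge> 1"
  shows "b \<le> window t b x" "window t b x < b + t"
  using assms by (simp_all add: window_def)

lemma window_eq_iff:
  assumes "t \<ge> 1" and "b \<le> k" "k < b + t"
  shows "window t b x = k \<longleftrightarrow> [x = k] (mod t)"
proof -
  have "(k - b) mod t = k - b" using assms by simp
  then have "window t b x = k \<longleftrightarrow> [x - b = k - b] (mod t)" unfolding window_def cong_def by auto
  also have "\<dots> \<longleftrightarrow> [x = k] (mod t)" by (rule cong_iff_diff_eq) simp
  finally show ?thesis .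
qed

lemma window_cong: "[window t b x = x] (mod t)"
proof -
  have "[(x - b) mod t + b = (x - b) + b] (mod t)" by (intro cong_add) (simp_all add: cong_def)
  then show ?thesis by (simp add: window_def add.commute)
qed

lemma window_eq_window_iff: "window t b x = window t b y \<longleftrightarrow> [x = y] (mod t)"
proof -
  have "window t b x = window t b y \<longleftrightarrow> [x - b = y - b] (mod t)" by (simp add: window_def cong_def)
  also have "\<dots> \<longleftrightarrow> [x = y] (mod t)" by (rule cong_iff_diff_eq) simp
  finally show ?thesis .
qed

lemma window_reflect:
  assumes "t \<ge> 1" and "b \<le> k" "k < b + t" and "[a - window t b x = k] (mod t)"
  shows "window t b (a - x) = k"
proof -
  have "[a - x = a - window t b x] (mod t)"
    using window_cong[of t b x] by (intro cong_diff cong_refl) (rule cong_sym)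
  then have "[a - x = k] (mod t)" using assms(4) by (rule cong_trans)
  then show ?thesis using window_eq_iff[OF assms(1-3)] by simp
qed

lemma card_window_class:
  assumes "t \<ge> 1" and "b \<le> i" "i < b + t"
  shows "card {z \<in> s_set s p. window t b z = i} = s_set_count s t p i"
proof -
  have "{z \<in> s_set s p. window t b z = i} = s_set s p \<inter> {m. [m = i] (mod t)}"
    by (auto simp: window_eq_iff[OF assms])
  then show ?thesis by (simp add: s_set_count_def)
qed

lemma s_set_symmetric:
  assumes "p \<in> self_conj_cores s" and "s \<ge> 2"
  shows "finite (s_set s p)" and "s - 1 - m \<in> s_set s p \<longleftrightarrow> m \<in> s_set s p"
    and "s = 2 * u + 1 \<Longrightarrow> u \<in> s_set s p"
proof -
  interpret flush_bead_set s "beta_set p" by (rule self_conj_core_bead_set(1)[OF assms])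
  have S: "s_set s p = S" by (rule s_set_eq_first_gaps) (rule flush_bead_set_axioms)
  have reflS: "s - 1 - m \<in> S \<longleftrightarrow> m \<in> S" for m
    by (rule first_gaps_reflect) (rule self_conj_core_bead_set(2)[OF assms])
  show "finite (s_set s p)" unfolding S by (rule finite_S)
  show "s - 1 - m \<in> s_set s p \<longleftrightarrow> m \<in> s_set s p" unfolding S by (rule reflS)
  assume u: "s = 2 * u + 1"
  \<comment> \<open>the reflection preserves the class of \<open>u\<close>, hence its representative\<close>
  have "rep u = s - 1 - rep u"
  proof (rule rep_eqI)
    show "s - 1 - rep u \<in> S" using reflS rep(1) by blast
    have "[rep u = u] (mod s)" by (rule rep(2))
    moreover have "rep u - u = u - (s - 1 - rep u)" using u by simp
    ultimately show "[s - 1 - rep u = u] (mod s)" using cong_iff_diff_eq_swap by blast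
  qed
  then have "rep u = u" using u by simp
  then show "u \<in> s_set s p" using rep(1)[of u] S by simp
qed

lemma equivariant_perms_remove_fixed_point:
  assumes "x \<in> D" and "\<rho> x = x" and "\<And>z. z \<in> D \<Longrightarrow> \<rho> z = z \<Longrightarrow> z = x"
  shows "equivariant_perms \<rho> \<kappa> D = equivariant_perms \<rho> \<kappa> (D - {x})"
proof -
  have "\<pi> x = x" if \<pi>: "\<pi> \<in> equivariant_perms \<rho> \<kappa> D" for \<pi>
  proof (rule assms(3))
    show "\<pi> x \<in> D" using \<pi> assms(1) by (simp add: equivariant_perms_def permutes_in_image)
    have "\<pi> (\<rho> x) = \<rho> (\<pi> x)" using \<pi> assms(1) by (simp add: equivariant_perms_def)
    then show "\<rho> (\<pi> x) = \<pi> x" using assms(2) by simp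
  qed
  then have "equivariant_perms \<rho> \<kappa> D = {\<pi> \<in> equivariant_perms \<rho> \<kappa> D. \<pi> x = x}" by blast
  also have "\<dots> = equivariant_perms \<rho> \<kappa> (D - {x, \<rho> x})"
    by (rule equivariant_perms_remove_orbit) (simp_all add: assms(1,2))
  finally show ?thesis using assms(2) by simp
qed

text \<open>
  For odd \<open>s\<close> the reflection fixes exactly one point of the \<open>s\<close>-set, its centre \<open>u\<close>.  All equivariant
  permutations fix it too, so it only makes the size of its class modulo \<open>t\<close> odd.  The function
  \<open>h\<close> describes the pairing of classes on representatives.  The cases of odd and even \<open>t\<close> differ in the
  set \<open>J\<close> of self-paired classes other than that of \<open>u\<close>.
\<close>

lemma card_StabSC_odd:
  assumes s: "s \<ge> 2" and t: "t \<ge> 1" and co: "coprime s t" and p: "p \<in> self_conj_cores s"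
    and u: "s = 2 * u + 1" and b: "b \<le> u" "u < b + t"
    and h: "\<And>k. b \<le> k \<Longrightarrow> k < b + t \<Longrightarrow> b \<le> h k \<and> h k < b + t \<and> [2 * u - k = h k] (mod t)"
    and I: "I \<subseteq> {b..<b + t}" "\<And>i. i \<in> I \<Longrightarrow> h i \<notin> I \<union> insert u J"
    and J: "J \<subseteq> {b..<b + t}" "\<And>j. j \<in> J \<Longrightarrow> h j = j" "I \<inter> insert u J = {}" "u \<notin> J" "h u = u"
    and cover: "\<And>k. b \<le> k \<Longrightarrow> k < b + t \<Longrightarrow> k \<in> I \<union> insert u J \<or> h k \<in> I"
  shows "\<exists>y. s_set_count s t p u = 2 * y + 1 \<and> (\<forall>j\<in>J. even (s_set_count s t p j)) \<and>
    card (StabSC s t p) = 2 ^ y * fact y *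
      (\<Prod>j\<in>J. 2 ^ (s_set_count s t p j div 2) * fact (s_set_count s t p j div 2)) *
      (\<Prod>i\<in>I. fact (s_set_count s t p i))"
proof -
  let ?\<kappa> = "window t b" and ?\<rho> = "\<lambda>m. s - 1 - m" and ?c = "s_set_count s t p"
  define D where "D = s_set s p - {u}"
  note S = s_set_symmetric[OF p s]
  have finI: "finite I" and finJ: "finite J" using I(1) J(1) finite_subset by blast+
  have D: "card {z \<in> D. ?\<kappa> z = i} = ?c i" if "b \<le> i" "i < b + t" "i \<noteq> u" for i
  proof -
    have "?\<kappa> u = u" using window_eq_iff[OF t b, of u] by simp
    then have "{z \<in> D. ?\<kappa> z = i} = {z \<in> s_set s p. ?\<kappa> z = i}" using that(3) by (auto simp: D_def)
    then show ?thesis using card_window_class[OF t that(1,2)] by simp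
  qed
  have Du: "?c u = Suc (card {z \<in> D. ?\<kappa> z = u})"
  proof -
    have "?\<kappa> u = u" using window_eq_iff[OF t b, of u] by simp
    then have "{z \<in> s_set s p. ?\<kappa> z = u} = insert u {z \<in> D. ?\<kappa> z = u}"
      using S(3)[OF u] by (auto simp: D_def)
    then show ?thesis using card_window_class[OF t b, of s p] S(1) by (simp add: D_def)
  qed
  have "equivariant_perms ?\<rho> ?\<kappa> (s_set s p) = equivariant_perms ?\<rho> ?\<kappa> D"
    unfolding D_def using S(3)[OF u] u by (intro equivariant_perms_remove_fixed_point) auto
  then have stab: "card (StabSC s t p) = card (equivariant_perms ?\<rho> ?\<kappa> D)"
    using card_StabSC[OF s t co p window_eq_window_iff, of b] by simp
  have wb: "b \<le> ?\<kappa> z" "?\<kappa> z < b + t" for z by (rule window_bounds[OF t])+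
  have "(\<forall>j\<in>insert u J. even (card {z \<in> D. ?\<kappa> z = j})) \<and>
    card (equivariant_perms ?\<rho> ?\<kappa> D) =
    (\<Prod>j\<in>insert u J. 2 ^ (card {z \<in> D. ?\<kappa> z = j} div 2) * fact (card {z \<in> D. ?\<kappa> z = j} div 2)) *
    (\<Prod>i\<in>I. fact (card {z \<in> D. ?\<kappa> z = i}))"
  proof (rule card_equivariant_perms[where h = h])
    show "?\<kappa> (?\<rho> z) = h (?\<kappa> z)" for z
      using h[OF wb, of z] u window_reflect[OF t, of b "h (?\<kappa> z)" "s - 1" z] by simp
    show "finite D" using S(1) by (simp add: D_def)
    show "?\<rho> z \<in> D" "?\<rho> z \<noteq> z" if "z \<in> D" for z
      using that S(2)[of z] u by (auto simp: D_def)
    show "h j = j" if "j \<in> insert u J" for j using that J by auto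
    show "?\<kappa> z \<in> I \<union> insert u J \<or> h (?\<kappa> z) \<in> I" for z using cover[OF wb] .
  qed (use I J finI finJ in auto)
  moreover have "?c j = card {z \<in> D. ?\<kappa> z = j}" if "j \<in> J" for j
    using that D[of j] subsetD[OF J(1) that] J(4) by (cases "j = u") auto
  moreover have "?c i = card {z \<in> D. ?\<kappa> z = i}" if "i \<in> I" for i
    using that D[of i] subsetD[OF I(1) that] J(3) by (cases "i = u") auto
  ultimately show ?thesis
    using Du J(4) finJ unfolding stab
    by (intro exI[of _ "card {z \<in> D. ?\<kappa> z = u} div 2"]) (simp add: mult.assoc mult.commute mult.left_commute)
qed

theorem proposition4p9:
  fixes s t u :: int and p :: "nat \<Rightarrow> nat" and c :: "int \<Rightarrow> nat"
  assumes "s \<ge> 2" and "t \<ge> 1" and "coprime s t"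
    and "u = s div 2"
    and "p \<in> self_conj_cores s"
    and "\<And>i. c i = s_set_count s t p i"
  shows "(odd s \<and> odd t \<longrightarrow>
           (\<exists>y. c u = 2 * y + 1 \<and>
              card (StabSC s t p) =
                2 ^ y * fact y * (\<Prod>i = u + 1..u + (t - 1) div 2. fact (c i))))
       \<and> (even t \<longrightarrow>
           (\<exists>y z. c u = 2 * y + 1 \<and> c (u + t div 2) = 2 * z \<and>
              card (StabSC s t p) =
                2 ^ (y + z) * fact y * fact z * (\<Prod>i = u + 1..u + (t - 2) div 2. fact (c i))))
       \<and> (even s \<longrightarrow>
           (\<exists>y. c (u + (t - 1) div 2) = 2 * y \<and>
              card (StabSC s t p) =
                2 ^ y * fact y * (\<Prod>i = u..u + (t - 3) div 2. fact (c i))))"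
proof (intro conjI impI)
  note basic = assms(1,2,3,5)
  have c: "s_set_count s t p = c" using assms(6) by auto
  show "\<exists>y. c u = 2 * y + 1 \<and>
      card (StabSC s t p) = 2 ^ y * fact y * (\<Prod>i = u + 1..u + (t - 1) div 2. fact (c i))"
    if odd: "odd s \<and> odd t"
  proof -
    obtain r where r: "t = 2 * r + 1" using odd by (auto elim: oddE)
    have su: "s = 2 * u + 1" using odd assms(4) by presburger
    have r0: "r \<ge> 0" "(t - 1) div 2 = r" using r assms(2) by simp_all
    have "\<exists>y. s_set_count s t p u = 2 * y + 1 \<and> (\<forall>j\<in>{}. even (s_set_count s t p j)) \<and>
      card (StabSC s t p) = 2 ^ y * fact y *
      (\<Prod>j\<in>{}. 2 ^ (s_set_count s t p j div 2) * fact (s_set_count s t p j div 2)) *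
      (\<Prod>i\<in>{u + 1..u + r}. fact (s_set_count s t p i))"
      by (rule card_StabSC_odd[OF basic su, of "u - r" "\<lambda>k. 2 * u - k"]) (use r r0 in auto)
    then show ?thesis unfolding c r0(2) by simp
  qed
  show "\<exists>y z. c u = 2 * y + 1 \<and> c (u + t div 2) = 2 * z \<and> card (StabSC s t p) =
      2 ^ (y + z) * fact y * fact z * (\<Prod>i = u + 1..u + (t - 2) div 2. fact (c i))"
    if even: "even t"
  proof -
    \<comment> \<open>here the window has \<open>t - 1\<close> elements symmetric about \<open>u\<close>, and one more self-paired class, \<open>u + r\<close>\<close>
    obtain r where r: "t = 2 * r" using even by blast
    have "odd s" using even assms(3) by (metis coprime_common_divisor odd_one)
    then have su: "s = 2 * u + 1" using assms(4) by presburger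
    have r0: "r \<ge> 1" "t div 2 = r" "(t - 2) div 2 = r - 1" using r assms(2) by simp_all
    have "\<exists>y. s_set_count s t p u = 2 * y + 1 \<and> (\<forall>j\<in>{u + r}. even (s_set_count s t p j)) \<and>
      card (StabSC s t p) = 2 ^ y * fact y *
      (\<Prod>j\<in>{u + r}. 2 ^ (s_set_count s t p j div 2) * fact (s_set_count s t p j div 2)) *
      (\<Prod>i\<in>{u + 1..u + (r - 1)}. fact (s_set_count s t p i))"
    proof (rule card_StabSC_odd[OF basic su, of "u - r + 1" "\<lambda>k. if k = u + r then u + r else 2 * u - k"])
      fix k assume k: "u - r + 1 \<le> k" "k < u - r + 1 + t"
      have "2 * u - (u + r) - (u + r) = t * (- 1)" using r by simp
      then have "[2 * u - (u + r) = u + r] (mod t)" unfolding cong_iff_dvd_diff by (simp only: dvd_triv_left)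
      then show "u - r + 1 \<le> (if k = u + r then u + r else 2 * u - k) \<and>
          (if k = u + r then u + r else 2 * u - k) < u - r + 1 + t \<and>
          [2 * u - k = (if k = u + r then u + r else 2 * u - k)] (mod t)"
        using k r r0 by auto
    qed (use r r0 in \<open>auto split: if_splits\<close>)
    then obtain y where y: "c u = 2 * y + 1" "even (c (u + r))"
      "card (StabSC s t p) = 2 ^ y * fact y * (2 ^ (c (u + r) div 2) * fact (c (u + r) div 2)) *
        (\<Prod>i\<in>{u + 1..u + (r - 1)}. fact (c i))"
      unfolding c by auto
    from y(2) obtain z where z: "c (u + r) = 2 * z" by blast
    show ?thesis unfolding r0(2,3) using y z by (intro exI[of _ y] exI[of _ z]) (simp add: power_add)
  qed
  show "\<exists>y. c (u + (t - 1) div 2) = 2 * y \<and>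
      card (StabSC s t p) = 2 ^ y * fact y * (\<Prod>i = u..u + (t - 3) div 2. fact (c i))"
    if even: "even s"
  proof -
    have "odd t" using even assms(3) by (metis coprime_common_divisor odd_one)
    then obtain r where r: "t = 2 * r + 1" by (auto elim: oddE)
    have su: "s = 2 * u" using even assms(4) by simp
    have r0: "r \<ge> 0" "(t - 1) div 2 = r" "(t - 3) div 2 = r - 1" using r assms(2) by simp_all
    \<comment> \<open>the reflection has the non-integral centre \<open>u - 1/2\<close>, so it has no fixed point\<close>
    let ?\<kappa> = "window t (u - r)" and ?\<rho> = "\<lambda>m. s - 1 - m" and ?S = "s_set s p"
    let ?h = "\<lambda>k. if k = u + r then u + r else 2 * u - 1 - k"
    note S = s_set_symmetric[OF assms(5,1)]
    have wb: "u - r \<le> ?\<kappa> z" "?\<kappa> z \<le> u + r" for z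
      using window_bounds[OF assms(2), of "u - r" z] r by simp_all
    have card: "card {z \<in> ?S. ?\<kappa> z = i} = c i" if "u - r \<le> i" "i \<le> u + r" for i
      using card_window_class[OF assms(2), of "u - r" i s p] that r c by simp
    have "(\<forall>j\<in>{u + r}. even (card {z \<in> ?S. ?\<kappa> z = j})) \<and>
      card (equivariant_perms ?\<rho> ?\<kappa> ?S) =
      (\<Prod>j\<in>{u + r}. 2 ^ (card {z \<in> ?S. ?\<kappa> z = j} div 2) * fact (card {z \<in> ?S. ?\<kappa> z = j} div 2)) *
      (\<Prod>i\<in>{u..u + (r - 1)}. fact (card {z \<in> ?S. ?\<kappa> z = i}))"
    proof (rule card_equivariant_perms[where h = ?h])
      fix z
      show "?\<kappa> (?\<rho> z) = ?h (?\<kappa> z)"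
      proof (rule window_reflect[OF assms(2)])
        have "s - 1 - (u + r) - (u + r) = t * (- 1)" using r su by simp
        then have "[s - 1 - (u + r) = u + r] (mod t)"
          unfolding cong_iff_dvd_diff by (simp only: dvd_triv_left)
        then show "[s - 1 - ?\<kappa> z = ?h (?\<kappa> z)] (mod t)" using su by simp
      qed (use wb[of z] r r0 in auto)
      show "?\<kappa> z \<in> {u..u + (r - 1)} \<union> {u + r} \<or> ?h (?\<kappa> z) \<in> {u..u + (r - 1)}"
        using wb[of z] by auto
      show "?\<rho> z \<noteq> z" using su by presburger
    qed (use S r0 in \<open>auto split: if_splits\<close>)
    then have "even (c (u + r))" "card (equivariant_perms ?\<rho> ?\<kappa> ?S) =
        2 ^ (c (u + r) div 2) * fact (c (u + r) div 2) * (\<Prod>i\<in>{u..u + (r - 1)}. fact (c i))"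
      using card r0(1) by simp_all
    moreover from this(1) obtain y where "c (u + r) = 2 * y" by blast
    ultimately show ?thesis
      unfolding r0(2,3) using card_StabSC[OF basic window_eq_window_iff, of "u - r"] by auto
  qed
qed

end
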